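(* Consider the discretization, the hyperbolic stages 1 and 2 with associated time steps $\tau_1,\tau_2$, the additive hyperbolic update $\mathbf u^n\mapsto\mathbf u^{\mathrm h,n}$, and the parabolic algorithm $\mathbf u^{\mathrm h,n}\mapsto \mathbf u^{n+1}$ described in the context. Assume that the space discretization satisfies the structural assumptions listed in the context, that $\mathbf u_i^n\in\mathcal A(b)$ for all $i\in\mathcal V$, and that the time step $\tau>0$ satisfies $\tau\le \frac{\tau_1\tau_2}{\tau_1+\tau_2}$. Let $\epsilon>0$ be the tolerance used in the parabolic algorithm, and let $\mathbf u^{n+1}=\{\mathbf u^{n+1}_i\}_{i\in\mathcal V}$ be the output of that algorithm. Then, for all $\epsilon>0$, the two-stage algorithm $\mathbf u^n\mapsto\mathbf u^{\mathrm h,n}\mapsto\mathbf u^{n+1}$ has the following properties: (i) it is invariant-domain preserving: $\mathbf u_i^{n+1}\in\mathcal A(b)$ for all $i\in\mathcal V$; (ii) it is conservative: $\sum_{i\in\mathcal V} m_i\rho_i^{n+1}=\sum_{i\in\mathcal V} m_i\rho_i^{n}$, $\sum_{i\in\mathcal V} m_i\mathbf m_i^{n+1}=\sum_{i\in\mathcal V} m_i\mathbf m_i^{n}$ and $\sum_{i\in\mathcal V} m_i E_{\mathrm{tot},i}^{n+1}=\sum_{i\in\mathcal V} m_iE_{\mathrm{tot},i}^{n}$.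
   Context: **States.** $d\in\{1,2,3\}$; states are $\mathbf u=(\rho,\mathbf m^{T},E_{\mathrm m},E_{\mathrm r})^{T}\in\mathbb R^{d+3}$ (density, momentum in $\mathbb R^d$, mechanical energy, radiation energy); $\mathbf v=\mathbf m/\rho$, $e(\mathbf u)=\rho^{-1}E_{\mathrm m}-\frac12\|\mathbf v\|^2$, $E_{\mathrm{tot}}=E_{\mathrm m}+E_{\mathrm r}$, with $\|\cdot\|$ the Euclidean norm. Fix $b\ge0$ and a quasiconcave function $e_{\mathrm{cold}}:(0,\frac1b)\to\mathbb R$ (the cold curve; $\frac1b=\infty$ if $b=0$). Set $\mathcal B(b)=\{\mathbf u:\rho>0,\ 1-b\rho>0,\ e_{\mathrm{cold}}(\rho)<e(\mathbf u)\}$ and $\mathcal A(b)=\{\mathbf u\in\mathcal B(b): E_{\mathrm r}>0\}$. The pressure is a given function $p:\mathcal B(b)\to\mathbb R$. The temperature $T:\mathcal B(b)\to[0,\infty)$ satisfies $e(\mathbf u)=c_{\mathrm v}(\rho,T(\mathbf u))\,T(\mathbf u)+e_{\mathrm{cold}}(\rho)$, where $c_{\mathrm v}(\rho,T)=\frac1T\int_0^T\mathfrak c_{\mathrm v}(\rho,\theta)\,d\theta$ is the average of the heat capacity at constant volume $\mathfrak c_{\mathrm v}>0$. The absorption and total cross sections are given functions $\sigma_{\mathrm a}(\rho,T)\ge0$ and $\sigma_{\mathrm t}(\rho,T)>0$. The speed of light $c>0$ and the radiation constant $a_{\mathrm r}>0$ are constants. **Discretization (structural assumptions).** Approximate states are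 collections $\{\mathbf u_i\}_{i\in\mathcal V}$ indexed by a finite set $\mathcal V$, partitioned as $\mathcal V=\mathcal V^{\circ}\cup\mathcal V^{\partial}$ (interior/boundary). Each $i\in\mathcal V$ has a stencil $\mathcal V(i)\subsetneq\mathcal V$, with $j\in\mathcal V(i)$ iff $i\in\mathcal V(j)$; $\mathcal V^*(i)=\mathcal V(i)\setminus\{i\}$. There are a diagonal low-order mass matrix with entries $m_i>0$ and an invertible symmetric high-order mass matrix $(m_{ij})$ with $m_{ij}=0$ if $j\notin\mathcal V(i)$ and $m_i=\sum_{j\in\mathcal V(i)}m_{ji}$. There are vectors $\mathbf c_{ij}\in\mathbb R^d$ (approximating the gradient on average) with $\mathbf c_{ij}=0$ if $j\notin\mathcal V(i)$, $\mathbf c_{ij}=-\mathbf c_{ji}$ whenever $i$ or $j$ is in $\mathcal V^\circ$, and $\sum_{j\in\mathcal V(i)}\mathbf c_{ij}=0$ for all $i$. For $\mathbf c_{ij}\ne0$, $\mathbf n_{ij}=\mathbf c_{ij}/\|\mathbf c_{ij}\|$; terms below multiplied by $\|\mathbf c_{ij}\|=0$ are zero. For each density and temperature distribution $(\rho,T)$ there is a real matrix $\mathbb K(\rho,T)=(k_{ij})$, approximating $E_{\mathrm r}\mapsto-\nabla\cdot(\frac{c}{3\sigma_{\mathrm t}(\rho,T)}\nabla E_{\mathrm r})$ and acting as $(\mathbb K E)_i=\sum_{j\in\mathcal V(i)}k_{ij}E_j$, with $k_{ij}=k_{ji}$, $k_{ij}\le0$ for $j\in\mathcal V^*(i)$,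 and $\sum_{j\in\mathcal V(i)}k_{ij}=0$. **Hyperbolic stage 1 (time step $s$).** $\mathbb g(\mathbf u)\in\mathbb R^{(d+3)\times d}$ has rows $\rho\mathbf v^T$, $\mathbf v\otimes\mathbf m+p(\mathbf u)\mathbb I_d$, $(E_{\mathrm m}+p(\mathbf u))\mathbf v^T$, $E_{\mathrm r}\mathbf v^T$. Set $\Gamma(\mathbf u)=\rho+p(\mathbf u)\frac{1-b\rho}{e(\mathbf u)}$. For a unit vector $\mathbf n$, $\hat\lambda(\mathbf n,\mathbf u_L,\mathbf u_R)$ is any upper bound on the maximum wave speed in the Riemann problem in direction $\mathbf n$ for the extended flux, i.e. for the one-dimensional system in $(\rho,\rho v,E_{\mathrm m},E_{\mathrm r},\Gamma)$ with flux $(\rho v,\ \rho v^2+\hat p,\ v(E_{\mathrm m}+\hat p),\ vE_{\mathrm r},\ v\Gamma)$, where $\hat p=\frac{\Gamma-\rho}{1-b\rho}e$ and $e=\rho^{-1}E_{\mathrm m}-\frac12v^2$, with left and right data given, for $Z\in\{L,R\}$, by $\big(\rho_Z,\ \mathbf m_Z\cdot\mathbf n,\ E_{\mathrm m,Z}-\frac12\rho_Z(\|\mathbf v_Z\|^2-(\mathbf v_Z\cdot\mathbf n)^2),\ E_{\mathrm r,Z},\ \Gamma(\mathbf u_Z)\big)$. For $j\in\mathcal V^*(i)$ set $d^1_{ij}=\max(\hat\lambda(\mathbf n_{ij},\mathbf u_i^n,\mathbf u_j^n)\|\mathbf c_{ij}\|,\ \hat\lambda(\mathbf n_{ji},\mathbf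 u_j^n,\mathbf u_i^n)\|\mathbf c_{ji}\|)$. The update with time step $s$ is $$m_i\mathbf u_i^{n,1}=m_i\mathbf u_i^n+s\sum_{j\in\mathcal V(i)}\Big(-(\mathbb g(\mathbf u_j^n)+\mathbb g(\mathbf u_i^n))\mathbf c_{ij}+d^1_{ij}(\mathbf u_j^n-\mathbf u_i^n)\Big).$$ **Hyperbolic stage 2 (time step $s$).** Let $\mathbf w=(\rho,\mathbf m^T,E_{\mathrm t})^T$ with $E_{\mathrm t}=E_{\mathrm r}+\frac12\rho\|\mathbf v\|^2$, $p_{\mathrm r}(\mathbf w)=\frac13(E_{\mathrm t}-\frac12\rho\|\mathbf v\|^2)$, and let $\mathbb k(\mathbf w)\in\mathbb R^{(d+2)\times d}$ have rows $\mathbf 0$, $p_{\mathrm r}\mathbb I_d$, $p_{\mathrm r}\mathbf v^T$. For a unit vector $\mathbf n$, $\hat\mu(\mathbf n,\mathbf w_L,\mathbf w_R)$ is any upper bound on the maximum wave speed in the one-dimensional Riemann problem $\partial_t\rho=0$, $\partial_t(\rho v)+\partial_xp_{\mathrm r}=0$, $\partial_tE+\partial_x(vp_{\mathrm r})=0$, $p_{\mathrm r}=\frac13(E-\frac12\rho v^2)$ (entropy solution: left shock or rarefaction, stationary contact, right shock or rarefaction; $p_{\mathrm r}=0$ allowed between the waves), with data $\rho_Z$, $v_Z=\mathbf v_Z\cdot\mathbf n$, $E_Z=E_{\mathrm r,Z}+\frac12\rho_Zv_Z^2$, $Z\in\{L,R\}$. For $j\in\mathcal V^*(i)$ set $d^2_{ij}=\max(\hat\mu(\mathbf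 n_{ij},\mathbf w_i^n,\mathbf w_j^n)\|\mathbf c_{ij}\|,\ \hat\mu(\mathbf n_{ji},\mathbf w_j^n,\mathbf w_i^n)\|\mathbf c_{ji}\|)$. The update with time step $s$ is $$m_i\mathbf w_i^{n,2}=m_i\mathbf w_i^n+s\sum_{j\in\mathcal V(i)}\Big(-(\mathbb k(\mathbf w_j^n)+\mathbb k(\mathbf w_i^n))\mathbf c_{ij}+d^2_{ij}(\mathbf w_j^n-\mathbf w_i^n)\Big),$$ and then $\mathbf u_i^{n,2}=(\rho_i^{n,2},(\mathbf m_i^{n,2})^T,E_{\mathrm m,i}^{n,2},E_{\mathrm r,i}^{n,2})^T$ with $\rho^{n,2},\mathbf m^{n,2}$ from $\mathbf w^{n,2}$, $\mathbf v^{n,2}=\mathbf m^{n,2}/\rho^{n,2}$, $E_{\mathrm m}^{n,2}=E_{\mathrm m}^n-\frac12\rho^n\|\mathbf v^n\|^2+\frac12\rho^{n,2}\|\mathbf v^{n,2}\|^2$ and $E_{\mathrm r}^{n,2}=E_{\mathrm t}^{n,2}-\frac12\rho^{n,2}\|\mathbf v^{n,2}\|^2$. **Additive hyperbolic update.** $\tau_k=\big(\max_{i\in\mathcal V}\frac2{m_i}\sum_{j\in\mathcal V^*(i)}d^k_{ij}\big)^{-1}$ for $k=1,2$, and $\theta=\frac{\tau_2}{\tau_1+\tau_2}$. Let $\mathbf u^{n,1}$ be the stage 1 update from $\mathbf u^n$ with time step $s=\tau/\theta$ and $\mathbf u^{n,2}$ the stage 2 update from the same $\mathbf u^n$ with time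 step $s=\tau/(1-\theta)$; then $\mathbf u^{\mathrm h,n}=\theta\mathbf u^{n,1}+(1-\theta)\mathbf u^{n,2}$. **Parabolic algorithm.** Let $T_i^n=T(\mathbf u_i^n)$, $T_i^{\mathrm h,n}=T(\mathbf u_i^{\mathrm h,n})$. For a positive vector $T^*=(T_i^* )_{i\in\mathcal V}$ consider the linear system for $(T_i,E_i)_{i\in\mathcal V}$: $$\rho_i^{\mathrm h,n}\big(c_{\mathrm v}(\rho_i^{\mathrm h,n},T_i^* )T_i-c_{\mathrm v}(\rho_i^{\mathrm h,n},T_i^{\mathrm h,n})T_i^{\mathrm h,n}\big)=-\tau\sigma_{\mathrm a}(\rho_i^{\mathrm h,n},T_i^* )c\,(a_{\mathrm r}(T_i^* )^3T_i-E_i),\qquad(\mathrm P1)$$ $$m_i(E_i-E_{\mathrm r,i}^{\mathrm h,n})+\tau(\mathbb K(\rho^{\mathrm h,n},T^* )E)_i=\tau m_i\sigma_{\mathrm a}(\rho_i^{\mathrm h,n},T_i^* )c\,(a_{\mathrm r}(T_i^* )^3T_i-E_i).\qquad(\mathrm P2)$$ Start with $T^*=T^n$ and repeat: compute $E_{\mathrm r}^{n+1}:=E$ by eliminating $T_i$ via (P1) and solving (P2) with the current $T^*$; set $T^{*,\mathrm{old}}=T^*$; for each $i$ replace $T_i^*$ by a positive approximate solution (computed by Newton's method up to the residual tolerance $\epsilon\,\tau\,\sigma_{\mathrm{a,ref}}\,c\,E_{\mathrm{r,ref}}$, with fixed reference values $\sigma_{\mathrm{a,ref}},E_{\mathrm{r,ref}}$)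 of $m_i\rho_i^{\mathrm h,n}c_{\mathrm v}(\rho_i^{\mathrm h,n},T_i^* )(T_i^*-T_i^{\mathrm h,n})=-\tau m_i\sigma_{\mathrm a}(\rho_i^{\mathrm h,n},T_i^* )c\,(a_{\mathrm r}(T_i^* )^4-E_{\mathrm r,i}^{n+1})$; stop when $\|T^*-T^{*,\mathrm{old}}\|_{\ell^1}/\|T^{*,\mathrm{old}}\|_{\ell^1}\le\epsilon$. Upon exit, $T_i^{n+1}$ is obtained from (P1) with $T^*$ replaced by $T^{*,\mathrm{old}}$ and $E_i=E_{\mathrm r,i}^{n+1}$, and $\rho^{n+1}=\rho^{\mathrm h,n}$, $\mathbf m^{n+1}=\mathbf m^{\mathrm h,n}$, $E_{\mathrm m,i}^{n+1}=\rho_i^{n+1}\big(c_{\mathrm v}(\rho_i^{n+1},T_i^{*,\mathrm{old}})T_i^{n+1}+e_{\mathrm{cold}}(\rho_i^{n+1})+\frac12\|\mathbf v_i^{n+1}\|^2\big)$, where $\mathbf v^{n+1}=\mathbf m^{n+1}/\rho^{n+1}$; $\mathbf u_i^{n+1}=(\rho_i^{n+1},(\mathbf m_i^{n+1})^T,E_{\mathrm m,i}^{n+1},E_{\mathrm r,i}^{n+1})^T$.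
   Formalization: Added: in (ii), the sums over i of c_ij vanish for boundary j (else boundary fluxes spoil conservation); T(u^h) is defined, i.e. e_cold(ρ^h)<e(u^h) wherever e_cold(ρ^h)>0 (this can fail); the stage 1 Riemann data have e>0 and p>0. *)

theory Defs
  imports "HOL-Analysis.Analysis"
begin

section \<open>States and admissible sets\<close>

text \<open>A state is \<open>(\<rho>, m, E\<^sub>m, E\<^sub>r)\<close>.\<close>

type_synonym 'd state = "real \<times> (real ^ 'd) \<times> real \<times> real"

definition dens :: "'d::finite state \<Rightarrow> real" where
  "dens u = (case u of (\<rho>, m, Em, Er) \<Rightarrow> \<rho>)"

definition mom :: "'d::finite state \<Rightarrow> real ^ 'd" where
  "mom u = (case u of (\<rho>, m, Em, Er) \<Rightarrow> m)"

definition Emech :: "'d::finite state \<Rightarrow> real" where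
  "Emech u = (case u of (\<rho>, m, Em, Er) \<Rightarrow> Em)"

definition Erad :: "'d::finite state \<Rightarrow> real" where
  "Erad u = (case u of (\<rho>, m, Em, Er) \<Rightarrow> Er)"

definition Etot :: "'d::finite state \<Rightarrow> real" where
  "Etot u = Emech u + Erad u"

definition vel :: "'d::finite state \<Rightarrow> real ^ 'd" where
  "vel u = mom u /\<^sub>R dens u"

definition internal :: "'d::finite state \<Rightarrow> real" where
  "internal u = Emech u / dens u - (norm (vel u))\<^sup>2 / 2"

text \<open>The interval \<open>(0, 1/b)\<close>, which is \<open>(0, \<infinity>)\<close> for \<open>b = 0\<close>.\<close>

definition dens_interval :: "real \<Rightarrow> real set" where
  "dens_interval b = {\<rho>. 0 < \<rho> \<and> 0 < 1 - b * \<rho>}"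

definition Bset :: "real \<Rightarrow> (real \<Rightarrow> real) \<Rightarrow> 'd::finite state set" where
  "Bset b ecold = {u. dens u > 0 \<and> 1 - b * dens u > 0 \<and> ecold (dens u) < internal u}"

definition Aset :: "real \<Rightarrow> (real \<Rightarrow> real) \<Rightarrow> 'd::finite state set" where
  "Aset b ecold = {u \<in> Bset b ecold. Erad u > 0}"

definition quasiconcave_on :: "real set \<Rightarrow> (real \<Rightarrow> real) \<Rightarrow> bool" where
  "quasiconcave_on S f \<longleftrightarrow>
     (\<forall>x\<in>S. \<forall>y\<in>S. \<forall>t\<in>{0..1}. min (f x) (f y) \<le> f ((1 - t) * x + t * y))"

section \<open>Constitutive data\<close>

definition avg_cv :: "(real \<Rightarrow> real \<Rightarrow> real) \<Rightarrow> real \<Rightarrow> real \<Rightarrow> real" where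
  "avg_cv hc \<rho> T = 1 / T * integral {0..T} (hc \<rho>)"

text \<open>The functions are total, but nothing is assumed about them outside their mathematical
  domains: \<open>ecold\<close> outside \<open>(0, 1/b)\<close>, \<open>T\<close> outside \<open>B(b)\<close>, and \<open>hc\<close>, \<open>\<sigma>a\<close>, \<open>\<sigma>t\<close> outside
  \<open>(0, 1/b) \<times> (0, \<infinity>)\<close>.\<close>

locale material =
  fixes b :: real
    and ecold :: "real \<Rightarrow> real"
    and hc :: "real \<Rightarrow> real \<Rightarrow> real"  \<comment> \<open>heat capacity at constant volume, as a function of density and temperature\<close>
    and T :: "'d::finite state \<Rightarrow> real"
    and \<sigma>a \<sigma>t :: "real \<Rightarrow> real \<Rightarrow> real"
    and cl ar :: real  \<comment> \<open>speed of light and radiation constant\<close>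
  assumes b_nonneg: "b \<ge> 0"
    and ecold_quasiconcave: "quasiconcave_on (dens_interval b) ecold"
    and hc_pos: "\<And>\<rho> t. \<rho> \<in> dens_interval b \<Longrightarrow> t > 0 \<Longrightarrow> hc \<rho> t > 0"
    and hc_integrable: "\<And>\<rho> t. \<rho> \<in> dens_interval b \<Longrightarrow> t > 0 \<Longrightarrow> hc \<rho> integrable_on {0..t}"
    and T_nonneg: "\<And>u. u \<in> Bset b ecold \<Longrightarrow> T u \<ge> 0"
    and T_eq: "\<And>u. u \<in> Bset b ecold \<Longrightarrow>
                 internal u = avg_cv hc (dens u) (T u) * T u + ecold (dens u)"
    and \<sigma>a_nonneg: "\<And>\<rho> t. \<rho> \<in> dens_interval b \<Longrightarrow> t > 0 \<Longrightarrow> \<sigma>a \<rho> t \<ge> 0"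
    and \<sigma>t_pos: "\<And>\<rho> t. \<rho> \<in> dens_interval b \<Longrightarrow> t > 0 \<Longrightarrow> \<sigma>t \<rho> t > 0"
    and cl_pos: "cl > 0"
    and ar_pos: "ar > 0"

section \<open>Space discretization\<close>

text \<open>\<open>N i\<close> is the stencil of \<open>i\<close>, \<open>m\<close> the low-order (diagonal) and \<open>M\<close> the high-order mass
  matrix.\<close>

locale discretization =
  fixes V Vint Vbd :: "'i set"
    and N :: "'i \<Rightarrow> 'i set"
    and m :: "'i \<Rightarrow> real"
    and M :: "'i \<Rightarrow> 'i \<Rightarrow> real"
    and c :: "'i \<Rightarrow> 'i \<Rightarrow> real ^ 'd::finite"
  assumes finite_V: "finite V"
    and partition: "V = Vint \<union> Vbd" "Vint \<inter> Vbd = {}"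
    and stencil: "\<And>i. i \<in> V \<Longrightarrow> N i \<subset> V"
    and stencil_sym: "\<And>i j. i \<in> V \<Longrightarrow> j \<in> V \<Longrightarrow> j \<in> N i \<longleftrightarrow> i \<in> N j"
    and m_pos: "\<And>i. i \<in> V \<Longrightarrow> m i > 0"
    and M_sym: "\<And>i j. i \<in> V \<Longrightarrow> j \<in> V \<Longrightarrow> M i j = M j i"
    and M_sparse: "\<And>i j. i \<in> V \<Longrightarrow> j \<in> V \<Longrightarrow> j \<notin> N i \<Longrightarrow> M i j = 0"
    and M_invertible: "\<exists>M'. \<forall>i\<in>V. \<forall>j\<in>V. (\<Sum>k\<in>V. M i k * M' k j) = (if i = j then 1 else 0)"
    and m_lumped: "\<And>i. i \<in> V \<Longrightarrow> m i = (\<Sum>j\<in>N i. M j i)"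
    and c_sparse: "\<And>i j. i \<in> V \<Longrightarrow> j \<in> V \<Longrightarrow> j \<notin> N i \<Longrightarrow> c i j = 0"
    and c_skew: "\<And>i j. i \<in> V \<Longrightarrow> j \<in> V \<Longrightarrow> i \<in> Vint \<or> j \<in> Vint \<Longrightarrow> c i j = - c j i"
    and c_sum: "\<And>i. i \<in> V \<Longrightarrow> (\<Sum>j\<in>N i. c i j) = 0"

definition diffusion_matrix ::
    "'i set \<Rightarrow> ('i \<Rightarrow> 'i set) \<Rightarrow> ('i \<Rightarrow> 'i \<Rightarrow> real) \<Rightarrow> bool" where
  "diffusion_matrix V N k \<longleftrightarrow>
     (\<forall>i\<in>V. \<forall>j\<in>V. k i j = k j i) \<and>
     (\<forall>i\<in>V. \<forall>j\<in>N i - {i}. k i j \<le> 0) \<and>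
     (\<forall>i\<in>V. (\<Sum>j\<in>N i. k i j) = 0)"

section \<open>Riemann problems\<close>

text \<open>Centered (self-similar) waves for \<open>\<partial>\<^sub>t U + \<partial>\<^sub>x F(U) = 0\<close>. \<open>lam\<close> is the characteristic speed
  of the wave family and \<open>D\<close> the set of admissible states.\<close>

definition rankine_hugoniot ::
    "('a::real_normed_vector \<Rightarrow> 'a) \<Rightarrow> real \<Rightarrow> 'a \<Rightarrow> 'a \<Rightarrow> bool" where
  "rankine_hugoniot F s U W \<longleftrightarrow> F W - F U = s *\<^sub>R (W - U)"

text \<open>A self-similar solution \<open>(x, t) \<mapsto> U(x/t)\<close> is smooth on the fan, so that \<open>(F \<circ> U)' = \<xi> U'\<close>;
  the end values may lie outside \<open>D\<close> (vacuum).\<close>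

definition centered_fan ::
    "('a::real_normed_vector \<Rightarrow> 'a) \<Rightarrow> ('a \<Rightarrow> real) \<Rightarrow> 'a set \<Rightarrow> (real \<Rightarrow> 'a) \<Rightarrow> real \<Rightarrow> real \<Rightarrow> bool"
  where
  "centered_fan F lam D U x0 x1 \<longleftrightarrow>
     x0 \<le> x1 \<and> continuous_on {x0..x1} U \<and> continuous_on {x0..x1} (\<lambda>\<xi>. F (U \<xi>)) \<and>
     (\<forall>\<xi>\<in>{x0<..<x1}. U \<xi> \<in> D \<and> lam (U \<xi>) = \<xi> \<and>
        (\<exists>U'. (U has_vector_derivative U') (at \<xi>) \<and>
              ((\<lambda>\<xi>. F (U \<xi>)) has_vector_derivative (\<xi> *\<^sub>R U')) (at \<xi>)))"

text \<open>The left wave connects the left datum \<open>UL\<close> to \<open>US\<close>; its leading edge moves with speed \<open>h\<close>: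
  the speed of a Lax shock, or the characteristic speed at the head of a rarefaction. A wave of
  zero strength counts as a degenerate rarefaction, of speed \<open>lam UL\<close>. Likewise on the right.\<close>

definition left_fan ::
    "('a::real_normed_vector \<Rightarrow> 'a) \<Rightarrow> ('a \<Rightarrow> real) \<Rightarrow> 'a set \<Rightarrow> 'a \<Rightarrow> 'a \<Rightarrow> real \<Rightarrow> real \<Rightarrow> bool" where
  "left_fan F lam D UL US h x \<longleftrightarrow>
     lam UL = h \<and> (\<exists>U. centered_fan F lam D U h x \<and> U h = UL \<and> U x = US)"

definition right_fan ::
    "('a::real_normed_vector \<Rightarrow> 'a) \<Rightarrow> ('a \<Rightarrow> real) \<Rightarrow> 'a set \<Rightarrow> 'a \<Rightarrow> 'a \<Rightarrow> real \<Rightarrow> real \<Rightarrow> bool" where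
  "right_fan F lam D US UR x h \<longleftrightarrow>
     lam UR = h \<and> (\<exists>U. centered_fan F lam D U x h \<and> U x = US \<and> U h = UR)"

definition left_wave ::
    "('a::real_normed_vector \<Rightarrow> 'a) \<Rightarrow> ('a \<Rightarrow> real) \<Rightarrow> 'a set \<Rightarrow> 'a \<Rightarrow> 'a \<Rightarrow> real \<Rightarrow> bool" where
  "left_wave F lam D UL US h \<longleftrightarrow>
     (rankine_hugoniot F h UL US \<and> lam US < h \<and> h < lam UL) \<or> (\<exists>x. left_fan F lam D UL US h x)"

definition right_wave ::
    "('a::real_normed_vector \<Rightarrow> 'a) \<Rightarrow> ('a \<Rightarrow> real) \<Rightarrow> 'a set \<Rightarrow> 'a \<Rightarrow> 'a \<Rightarrow> real \<Rightarrow> bool" where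
  "right_wave F lam D US UR h \<longleftrightarrow>
     (rankine_hugoniot F h US UR \<and> lam UR < h \<and> h < lam US) \<or> (\<exists>x. right_fan F lam D US UR x h)"

text \<open>All waves travel with speeds between those of the two extreme edges, so the maximum wave
  speed is the larger of the moduli of the latter.\<close>

definition max_wave_speed_bound :: "(real \<Rightarrow> real \<Rightarrow> bool) \<Rightarrow> real \<Rightarrow> bool" where
  "max_wave_speed_bound riemann s \<longleftrightarrow> (\<exists>hL hR. riemann hL hR \<and> max \<bar>hL\<bar> \<bar>hR\<bar> \<le> s)"

subsection \<open>Stage 1: extended Euler system\<close>

text \<open>One-dimensional states \<open>(\<rho>, \<rho>v, E\<^sub>m, E\<^sub>r, \<Gamma>)\<close>.\<close>

type_synonym ext_state = "real \<times> real \<times> real \<times> real \<times> real"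

definition ext_vel :: "ext_state \<Rightarrow> real" where
  "ext_vel U = (case U of (\<rho>, q, E, R, G) \<Rightarrow> q / \<rho>)"

definition ext_internal :: "ext_state \<Rightarrow> real" where
  "ext_internal U = (case U of (\<rho>, q, E, R, G) \<Rightarrow> E / \<rho> - (q / \<rho>)\<^sup>2 / 2)"

definition ext_pressure :: "real \<Rightarrow> ext_state \<Rightarrow> real" where
  "ext_pressure b U =
     (case U of (\<rho>, q, E, R, G) \<Rightarrow> (G - \<rho>) / (1 - b * \<rho>) * ext_internal U)"

definition ext_flux :: "real \<Rightarrow> ext_state \<Rightarrow> ext_state" where
  "ext_flux b U =
     (case U of (\<rho>, q, E, R, G) \<Rightarrow>
        (let v = ext_vel U; ph = ext_pressure b U
         in (\<rho> * v, \<rho> * v\<^sup>2 + ph, v * (E + ph), v * R, v * G)))"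

text \<open>\<open>\<Gamma>/\<rho> > 1\<close> is the (transported) adiabatic exponent of the covolume law
  \<open>p = (\<Gamma>/\<rho> - 1) \<rho> e / (1 - b\<rho>)\<close>, whose sound speed is \<open>a\<^sup>2 = (\<Gamma>/\<rho>) p / (\<rho> (1 - b\<rho>))\<close>.\<close>

definition ext_states :: "real \<Rightarrow> ext_state set" where
  "ext_states b =
     {(\<rho>, q, E, R, G) |\<rho> q E R G.
        \<rho> > 0 \<and> 1 - b * \<rho> > 0 \<and> ext_internal (\<rho>, q, E, R, G) > 0 \<and> G > \<rho>}"

definition ext_sound :: "real \<Rightarrow> ext_state \<Rightarrow> real" where
  "ext_sound b U =
     (case U of (\<rho>, q, E, R, G) \<Rightarrow> sqrt (G / \<rho> * ext_pressure b U / (\<rho> * (1 - b * \<rho>))))"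

text \<open>Left wave, contact moving with the fluid, right wave; or two rarefactions separated by
  vacuum (the state \<open>0\<close>, at which the flux is \<open>0\<close> as well).\<close>

definition ext_riemann :: "real \<Rightarrow> ext_state \<Rightarrow> ext_state \<Rightarrow> real \<Rightarrow> real \<Rightarrow> bool" where
  "ext_riemann b UL UR hL hR \<longleftrightarrow>
     (let F = ext_flux b; D = ext_states b;
          lam1 = (\<lambda>U. ext_vel U - ext_sound b U);
          lam3 = (\<lambda>U. ext_vel U + ext_sound b U)
      in UL \<in> D \<and> UR \<in> D \<and>
         ((\<exists>US\<in>D. \<exists>UT\<in>D. left_wave F lam1 D UL US hL \<and>
             rankine_hugoniot F (ext_vel US) US UT \<and> right_wave F lam3 D UT UR hR) \<or>
          (\<exists>xL xR. left_fan F lam1 D UL 0 hL xL \<and> xL \<le> xR \<and> right_fan F lam3 D 0 UR xR hR)))"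

definition Gam :: "real \<Rightarrow> ('d::finite state \<Rightarrow> real) \<Rightarrow> 'd state \<Rightarrow> real" where
  "Gam b p u = dens u + p u * ((1 - b * dens u) / internal u)"

definition ext_data ::
    "real \<Rightarrow> ('d::finite state \<Rightarrow> real) \<Rightarrow> real ^ 'd \<Rightarrow> 'd state \<Rightarrow> ext_state" where
  "ext_data b p n u =
     (dens u, mom u \<bullet> n,
      Emech u - dens u / 2 * ((norm (vel u))\<^sup>2 - (vel u \<bullet> n)\<^sup>2), Erad u, Gam b p u)"

subsection \<open>Stage 2: radiation pressure system\<close>

text \<open>One-dimensional states \<open>(\<rho>, \<rho>v, E)\<close>.\<close>

type_synonym rad1_state = "real \<times> real \<times> real"

definition rad1_vel :: "rad1_state \<Rightarrow> real" where
  "rad1_vel W = (case W of (\<rho>, q, E) \<Rightarrow> q / \<rho>)"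

definition rad1_pressure :: "rad1_state \<Rightarrow> real" where
  "rad1_pressure W = (case W of (\<rho>, q, E) \<Rightarrow> 1 / 3 * (E - \<rho> * (q / \<rho>)\<^sup>2 / 2))"

definition rad1_flux :: "rad1_state \<Rightarrow> rad1_state" where
  "rad1_flux W = (0, rad1_pressure W, rad1_vel W * rad1_pressure W)"

definition rad1_states :: "rad1_state set" where
  "rad1_states = {(\<rho>, q, E) |\<rho> q E. \<rho> > 0 \<and> rad1_pressure (\<rho>, q, E) \<ge> 0}"

text \<open>In primitive variables \<open>\<rho> \<partial>\<^sub>t v + \<partial>\<^sub>x p = 0\<close> and \<open>3 \<partial>\<^sub>t p + p \<partial>\<^sub>x v = 0\<close>, so the characteristic
  speeds are \<open>0\<close> and \<open>\<plusminus> sqrt (p / (3\<rho>))\<close>.\<close>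

definition rad1_speed :: "rad1_state \<Rightarrow> real" where
  "rad1_speed W = (case W of (\<rho>, q, E) \<Rightarrow> sqrt (rad1_pressure W / (3 * \<rho>)))"

text \<open>Across the stationary contact \<open>p\<close> is continuous, and so is \<open>v\<close> if \<open>p > 0\<close>. If \<open>p = 0\<close>
  between the waves, \<open>v\<close> may jump, but only upwards: otherwise the two rarefactions would have
  to interact.\<close>

definition rad1_riemann :: "rad1_state \<Rightarrow> rad1_state \<Rightarrow> real \<Rightarrow> real \<Rightarrow> bool" where
  "rad1_riemann WL WR hL hR \<longleftrightarrow>
     (let F = rad1_flux; D = rad1_states
      in WL \<in> D \<and> WR \<in> D \<and>
         (\<exists>WS\<in>D. \<exists>WT\<in>D. left_wave F (\<lambda>W. - rad1_speed W) D WL WS hL \<and>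
            rankine_hugoniot F 0 WS WT \<and> rad1_vel WS \<le> rad1_vel WT \<and>
            right_wave F rad1_speed D WT WR hR))"

section \<open>Hyperbolic update\<close>

text \<open>\<open>flux p u x\<close> is the matrix-vector product \<open>g(u) x\<close>.\<close>

definition flux :: "('d::finite state \<Rightarrow> real) \<Rightarrow> 'd state \<Rightarrow> real ^ 'd \<Rightarrow> 'd state" where
  "flux p u x =
     (dens u * (vel u \<bullet> x), (mom u \<bullet> x) *\<^sub>R vel u + p u *\<^sub>R x,
      (Emech u + p u) * (vel u \<bullet> x), Erad u * (vel u \<bullet> x))"

text \<open>\<open>sgn x\<close> is the unit vector \<open>x / \<parallel>x\<parallel>\<close>. \<open>lam n zL zR\<close> is the wave speed bound.\<close>

definition graph_viscosity ::
    "(real ^ 'd::finite \<Rightarrow> 'z \<Rightarrow> 'z \<Rightarrow> real) \<Rightarrow> ('i \<Rightarrow> 'i \<Rightarrow> real ^ 'd) \<Rightarrow> ('i \<Rightarrow> 'z) \<Rightarrow> 'i \<Rightarrow> 'i \<Rightarrow> real"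
  where
  "graph_viscosity lam c z i j =
     max (lam (sgn (c i j)) (z i) (z j) * norm (c i j))
         (lam (sgn (c j i)) (z j) (z i) * norm (c j i))"

definition stage1 ::
    "('i \<Rightarrow> 'i set) \<Rightarrow> ('i \<Rightarrow> real) \<Rightarrow> ('i \<Rightarrow> 'i \<Rightarrow> real ^ 'd::finite) \<Rightarrow> ('d state \<Rightarrow> real) \<Rightarrow>
     ('i \<Rightarrow> 'i \<Rightarrow> real) \<Rightarrow> real \<Rightarrow> ('i \<Rightarrow> 'd state) \<Rightarrow> 'i \<Rightarrow> 'd state" where
  "stage1 N m c p d s u i =
     u i + (s / m i) *\<^sub>R
       (\<Sum>j\<in>N i. - (flux p (u j) (c i j) + flux p (u i) (c i j)) + d i j *\<^sub>R (u j - u i))"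

text \<open>States \<open>w = (\<rho>, m, E\<^sub>t)\<close> of the second stage.\<close>

type_synonym 'd rad_state = "real \<times> (real ^ 'd) \<times> real"

definition to_rad :: "'d::finite state \<Rightarrow> 'd rad_state" where
  "to_rad u = (dens u, mom u, Erad u + dens u * (norm (vel u))\<^sup>2 / 2)"

definition rad_pressure :: "'d::finite rad_state \<Rightarrow> real" where
  "rad_pressure w =
     (case w of (\<rho>, q, Et) \<Rightarrow> 1 / 3 * (Et - \<rho> * (norm (q /\<^sub>R \<rho>))\<^sup>2 / 2))"

definition rad_flux :: "'d::finite rad_state \<Rightarrow> real ^ 'd \<Rightarrow> 'd rad_state" where
  "rad_flux w x =
     (case w of (\<rho>, q, Et) \<Rightarrow>
        (0, rad_pressure w *\<^sub>R x, rad_pressure w * ((q /\<^sub>R \<rho>) \<bullet> x)))"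

text \<open>One-dimensional Riemann datum: \<open>\<rho>\<close>, \<open>\<rho> v\<^sub>n\<close> and \<open>E\<^sub>r + \<rho> v\<^sub>n\<^sup>2 / 2\<close> with \<open>v\<^sub>n = v \<bullet> n\<close>.\<close>

definition rad1_data :: "real ^ 'd::finite \<Rightarrow> 'd rad_state \<Rightarrow> rad1_state" where
  "rad1_data n w =
     (case w of (\<rho>, q, Et) \<Rightarrow>
        (\<rho>, \<rho> * ((q /\<^sub>R \<rho>) \<bullet> n),
         (Et - \<rho> * (norm (q /\<^sub>R \<rho>))\<^sup>2 / 2) + \<rho> * ((q /\<^sub>R \<rho>) \<bullet> n)\<^sup>2 / 2))"

definition stage2_rad ::
    "('i \<Rightarrow> 'i set) \<Rightarrow> ('i \<Rightarrow> real) \<Rightarrow> ('i \<Rightarrow> 'i \<Rightarrow> real ^ 'd::finite) \<Rightarrow>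
     ('i \<Rightarrow> 'i \<Rightarrow> real) \<Rightarrow> real \<Rightarrow> ('i \<Rightarrow> 'd rad_state) \<Rightarrow> 'i \<Rightarrow> 'd rad_state" where
  "stage2_rad N m c d s w i =
     w i + (s / m i) *\<^sub>R
       (\<Sum>j\<in>N i. - (rad_flux (w j) (c i j) + rad_flux (w i) (c i j)) + d i j *\<^sub>R (w j - w i))"

definition stage2 ::
    "('i \<Rightarrow> 'i set) \<Rightarrow> ('i \<Rightarrow> real) \<Rightarrow> ('i \<Rightarrow> 'i \<Rightarrow> real ^ 'd::finite) \<Rightarrow>
     ('i \<Rightarrow> 'i \<Rightarrow> real) \<Rightarrow> real \<Rightarrow> ('i \<Rightarrow> 'd state) \<Rightarrow> 'i \<Rightarrow> 'd state" where
  "stage2 N m c d s u i =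
     (case stage2_rad N m c d s (\<lambda>j. to_rad (u j)) i of (\<rho>, q, Et) \<Rightarrow>
        (\<rho>, q,
         Emech (u i) - dens (u i) * (norm (vel (u i)))\<^sup>2 / 2 + \<rho> * (norm (q /\<^sub>R \<rho>))\<^sup>2 / 2,
         Et - \<rho> * (norm (q /\<^sub>R \<rho>))\<^sup>2 / 2))"

definition max_time_step ::
    "'i set \<Rightarrow> ('i \<Rightarrow> 'i set) \<Rightarrow> ('i \<Rightarrow> real) \<Rightarrow> ('i \<Rightarrow> 'i \<Rightarrow> real) \<Rightarrow> real" where
  "max_time_step V N m d = inverse (Max ((\<lambda>i. 2 / m i * (\<Sum>j\<in>N i - {i}. d i j)) ` V))"

section \<open>Parabolic update\<close>

text \<open>Equations (P1) and (P2) at one node; \<open>Ts\<close> is the frozen temperature \<open>T\<^sup>*\<close>, \<open>Th\<close> the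
  temperature and \<open>Eh\<close> the radiation energy of the hyperbolic update, \<open>KE\<close> the value of
  \<open>K E\<close> at the node.\<close>

definition P1_eq ::
    "(real \<Rightarrow> real \<Rightarrow> real) \<Rightarrow> (real \<Rightarrow> real \<Rightarrow> real) \<Rightarrow> real \<Rightarrow> real \<Rightarrow> real \<Rightarrow>
     real \<Rightarrow> real \<Rightarrow> real \<Rightarrow> real \<Rightarrow> real \<Rightarrow> bool" where
  "P1_eq cv \<sigma>a cl ar \<tau> \<rho> Th Ts T E \<longleftrightarrow>
     \<rho> * (cv \<rho> Ts * T - cv \<rho> Th * Th) = - \<tau> * \<sigma>a \<rho> Ts * cl * (ar * Ts ^ 3 * T - E)"

definition P2_eq ::
    "(real \<Rightarrow> real \<Rightarrow> real) \<Rightarrow> real \<Rightarrow> real \<Rightarrow> real \<Rightarrow>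
     real \<Rightarrow> real \<Rightarrow> real \<Rightarrow> real \<Rightarrow> real \<Rightarrow> real \<Rightarrow> real \<Rightarrow> bool" where
  "P2_eq \<sigma>a cl ar \<tau> mi \<rho> Eh KE Ts T E \<longleftrightarrow>
     mi * (E - Eh) + \<tau> * KE = \<tau> * mi * \<sigma>a \<rho> Ts * cl * (ar * Ts ^ 3 * T - E)"

text \<open>Residual (left minus right side) of the nonlinear temperature equation solved by Newton's
  method.\<close>

definition newton_residual ::
    "(real \<Rightarrow> real \<Rightarrow> real) \<Rightarrow> (real \<Rightarrow> real \<Rightarrow> real) \<Rightarrow> real \<Rightarrow> real \<Rightarrow> real \<Rightarrow>
     real \<Rightarrow> real \<Rightarrow> real \<Rightarrow> real \<Rightarrow> real \<Rightarrow> real" where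
  "newton_residual cv \<sigma>a cl ar \<tau> mi \<rho> Th E Ts =
     mi * \<rho> * cv \<rho> Ts * (Ts - Th) - (- \<tau> * mi * \<sigma>a \<rho> Ts * cl * (ar * Ts ^ 4 - E))"

definition stop_test :: "'i set \<Rightarrow> real \<Rightarrow> ('i \<Rightarrow> real) \<Rightarrow> ('i \<Rightarrow> real) \<Rightarrow> bool" where
  "stop_test V \<epsilon> Told Tnew \<longleftrightarrow>
     (\<Sum>i\<in>V. \<bar>Tnew i - Told i\<bar>) / (\<Sum>i\<in>V. \<bar>Told i\<bar>) \<le> \<epsilon>"

text \<open>A run of the algorithm: \<open>Ts l\<close> is the value of \<open>T\<^sup>*\<close> at the beginning of pass \<open>l\<close>, \<open>E l\<close> the
  radiation energy computed in pass \<open>l\<close> (and \<open>Tl l\<close> the temperature eliminated there), and \<open>k\<close>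
  is the first pass after which the stopping test succeeds. Any positive value meeting the
  tolerance is a possible result of the Newton iteration.\<close>

definition parabolic_output ::
    "'i set \<Rightarrow> ('i \<Rightarrow> 'i set) \<Rightarrow> ('i \<Rightarrow> real) \<Rightarrow>
     (('i \<Rightarrow> real) \<Rightarrow> ('i \<Rightarrow> real) \<Rightarrow> 'i \<Rightarrow> 'i \<Rightarrow> real) \<Rightarrow>
     (real \<Rightarrow> real) \<Rightarrow> (real \<Rightarrow> real \<Rightarrow> real) \<Rightarrow> (real \<Rightarrow> real \<Rightarrow> real) \<Rightarrow> real \<Rightarrow> real \<Rightarrow>
     real \<Rightarrow> real \<Rightarrow> real \<Rightarrow> real \<Rightarrow>
     ('i \<Rightarrow> real) \<Rightarrow> ('i \<Rightarrow> real) \<Rightarrow> ('i \<Rightarrow> 'd::finite state) \<Rightarrow> ('i \<Rightarrow> 'd state) \<Rightarrow> bool" where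
  "parabolic_output V N m K ecold cv \<sigma>a cl ar \<sigma>ref Eref \<epsilon> \<tau> Tn Th uh unew \<longleftrightarrow>
     (let \<rho> = (\<lambda>i. dens (uh i)) in
      \<exists>k Ts E Tl Tnew.
        (\<forall>i\<in>V. Ts 0 i = Tn i) \<and>
        (\<forall>l\<le>k. \<forall>i\<in>V.
           P1_eq cv \<sigma>a cl ar \<tau> (\<rho> i) (Th i) (Ts l i) (Tl l i) (E l i) \<and>
           P2_eq \<sigma>a cl ar \<tau> (m i) (\<rho> i) (Erad (uh i))
             (\<Sum>j\<in>N i. K \<rho> (Ts l) i j * E l j) (Ts l i) (Tl l i) (E l i) \<and>
           Ts (Suc l) i > 0 \<and>
           \<bar>newton_residual cv \<sigma>a cl ar \<tau> (m i) (\<rho> i) (Th i) (E l i) (Ts (Suc l) i)\<bar>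
             \<le> \<epsilon> * \<tau> * \<sigma>ref * cl * Eref) \<and>
        (\<forall>l<k. \<not> stop_test V \<epsilon> (Ts l) (Ts (Suc l))) \<and>
        stop_test V \<epsilon> (Ts k) (Ts (Suc k)) \<and>
        (\<forall>i\<in>V.
           P1_eq cv \<sigma>a cl ar \<tau> (\<rho> i) (Th i) (Ts k i) (Tnew i) (E k i) \<and>
           unew i =
             (\<rho> i, mom (uh i),
              \<rho> i * (cv (\<rho> i) (Ts k i) * Tnew i + ecold (\<rho> i)
                + (norm (mom (uh i) /\<^sub>R \<rho> i))\<^sup>2 / 2),
              E k i)))"

end

theory Submission
  imports Defs
begin

text \<open>Both hyperbolic stages are convex combinations. Since \<open>\<Sum>\<^sub>j c\<^sub>i\<^sub>j = 0\<close>, the update at \<open>i\<close> combines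
  \<open>u\<^sub>i\<close> with the bar states \<open>(u\<^sub>i + u\<^sub>j) / 2 - (g(u\<^sub>j) - g(u\<^sub>i)) c\<^sub>i\<^sub>j / (2 d\<^sub>i\<^sub>j)\<close>, and the time step restriction
  makes all weights nonnegative. The sets to be preserved are intersections of open half-spaces:
  density, covolume and radiation energy are affine, and for positive density \<open>e > 0\<close> is equivalent
  to the family of linear inequalities \<open>E\<^sub>m - m \<bullet> t + \<rho> \<parallel>t\<parallel>\<^sup>2 / 2 > 0\<close>, one for each velocity \<open>t\<close>
  (the energy seen by an observer moving with velocity \<open>t\<close>). So everything reduces to the sign of
  an affine functional \<open>l + k\<close> at a bar state.

  A bar state is the mean of the Riemann solution over \<open>\<bar>x / t\<bar> \<le> s\<close>, for a speed \<open>s\<close> that bounds all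
  wave speeds. Integration is avoided by following the potential
  \<open>\<xi> (l(U) + k) - l(F(U))\<close> along the solution from \<open>\<xi> = - s\<close> to \<open>\<xi> = s\<close>: its total increment is
  \<open>2 s\<close> times the value of \<open>l + k\<close> at the bar state. It has slope \<open>l(U) + k\<close> where \<open>U\<close> is constant
  or a centered fan, and the Rankine-Hugoniot condition makes it continuous at discontinuities, so
  it increases as soon as \<open>l + k\<close> is positive on the states of the solution (\<open>left_wave_gain\<close>).
  Right waves are mirror images of left waves.

  In several space dimensions, the flux in a direction \<open>n\<close> is the one-dimensional flux together with
  quantities that the fluid carries along, such as the transverse kinetic energy per unit mass,
  with different values on the two sides of the contact. Nothing crosses the
  contact, so the functional may use a different multiple of the density on each side
  (\<open>ext_riemann_average_pos\<close>, \<open>rad1_riemann_average_pos\<close>). Radiation energy in the first stage is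
  treated in the same way, as a multiple of the density on each side.

  This argument gives \<open>e > 0\<close> for the hyperbolic update, hence \<open>e > e\<^sub>c\<^sub>o\<^sub>l\<^sub>d\<close> where the cold curve is
  nonpositive; elsewhere the existence of the temperature states the same bound. It needs \<open>e > 0\<close>
  at \<open>u\<^sub>i\<close>, which holds as soon as \<open>i\<close> takes part in some Riemann problem; all other nodes are left
  unchanged.

  In the parabolic update, the diffusion term is nonpositive at a node where the radiation energy
  is minimal, and eliminating the temperature there shows that the minimum is positive
  (\<open>implicit_exchange_pos\<close>); then the temperature is positive as well. Conservation holds because
  the fluxes, the graph viscosity and the diffusion each sum to zero, and the exchange terms of
  the two equations cancel. Only the last pass of the iteration enters, and it solves its linear
  equations exactly, whence the conclusions for every tolerance.\<close>

section \<open>Linear functionals across centered waves\<close>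

text \<open>For a self-similar solution \<open>U\<close>, the increment of this quantity between two values of \<open>\<xi>\<close> is the
  integral of \<open>l \<circ> U + k\<close> between them.\<close>

definition wave_potential ::
    "('a::real_normed_vector \<Rightarrow> 'a) \<Rightarrow> ('a \<Rightarrow> real) \<Rightarrow> real \<Rightarrow> real \<Rightarrow> 'a \<Rightarrow> real" where
  "wave_potential F l k \<xi> U = \<xi> * (l U + k) - l (F U)"

lemma wave_potential_shock:
  assumes "linear l" and "rankine_hugoniot F s U W"
  shows "wave_potential F l k s U = wave_potential F l k s W"
proof -
  have "l (F W) - l (F U) = s * (l W - l U)"
    using arg_cong[OF assms(2)[unfolded rankine_hugoniot_def], of l]
    by (simp add: linear_diff[OF assms(1)] linear_scale[OF assms(1)])
  then show ?thesis
    by (simp add: wave_potential_def algebra_simps)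
qed

lemma wave_potential_mono:
  "\<xi> \<le> \<eta> \<Longrightarrow> 0 \<le> l U + k \<Longrightarrow> wave_potential F l k \<xi> U \<le> wave_potential F l k \<eta> U"
  by (simp add: wave_potential_def mult_right_mono)

lemma wave_potential_strict_mono:
  "\<xi> < \<eta> \<Longrightarrow> 0 < l U + k \<Longrightarrow> wave_potential F l k \<xi> U < wave_potential F l k \<eta> U"
  by (simp add: wave_potential_def)

text \<open>On the fan \<open>(F \<circ> U)' = \<xi> U'\<close>, so the derivative of the potential is \<open>l(U) + k\<close>. Positivity in
  the interior suffices, which allows the fan to end in vacuum.\<close>

lemma wave_potential_fan:
  assumes l: "bounded_linear l"
    and fan: "centered_fan F lam D U x0 x1" and "x0 < x1"
    and pos: "\<And>\<xi>. x0 < \<xi> \<Longrightarrow> \<xi> < x1 \<Longrightarrow> l (U \<xi>) + k > 0"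
  shows "wave_potential F l k x0 (U x0) < wave_potential F l k x1 (U x1)"
proof (rule DERIV_pos_imp_increasing_open[OF \<open>x0 < x1\<close>, of "\<lambda>\<xi>. wave_potential F l k \<xi> (U \<xi>)"])
  fix \<xi> assume \<xi>: "x0 < \<xi>" "\<xi> < x1"
  then obtain U' where U': "(U has_vector_derivative U') (at \<xi>)"
    "((\<lambda>\<xi>. F (U \<xi>)) has_vector_derivative (\<xi> *\<^sub>R U')) (at \<xi>)"
    using fan unfolding centered_fan_def by (meson greaterThanLessThan_iff)
  have 1: "((\<lambda>\<xi>. l (U \<xi>)) has_real_derivative l U') (at \<xi>)"
    using bounded_linear.has_vector_derivative[OF l U'(1)]
    by (simp add: has_real_derivative_iff_has_vector_derivative)
  have 2: "((\<lambda>\<xi>. l (F (U \<xi>))) has_real_derivative \<xi> * l U') (at \<xi>)"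
    using bounded_linear.has_vector_derivative[OF l U'(2)]
    by (simp add: has_real_derivative_iff_has_vector_derivative bounded_linear.linear[OF l] linear_scale)
  have "((\<lambda>\<xi>. wave_potential F l k \<xi> (U \<xi>)) has_real_derivative l (U \<xi>) + k) (at \<xi>)"
    unfolding wave_potential_def
    by (auto intro!: derivative_eq_intros 1 2)
  then show "\<exists>y. ((\<lambda>\<xi>. wave_potential F l k \<xi> (U \<xi>)) has_real_derivative y) (at \<xi>) \<and> 0 < y"
    using pos[OF \<xi>] by blast
next
  have "continuous_on {x0..x1} (\<lambda>\<xi>. l (U \<xi>))" "continuous_on {x0..x1} (\<lambda>\<xi>. l (F (U \<xi>)))"
    using fan bounded_linear.continuous_on[OF l] unfolding centered_fan_def by auto
  then show "continuous_on {x0..x1} (\<lambda>\<xi>. wave_potential F l k \<xi> (U \<xi>))"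
    unfolding wave_potential_def by (intro continuous_intros)
qed

text \<open>The gain across a left wave together with the constant state that separates it from the contact,
  whose speed is \<open>z\<close>. The functional need only be positive at states whose characteristic
  speed is less than \<open>z\<close>; this admits the radiation system, where the pressure, and the functional
  with it, may vanish between the waves.\<close>

lemma left_wave_gain:
  assumes l: "bounded_linear l"
    and wave: "left_wave F lam D UL US h" and D: "UL \<in> D" "US \<in> D"
    and nonneg: "\<And>U. U \<in> D \<Longrightarrow> l U + k \<ge> 0"
    and pos: "\<And>U. U \<in> D \<Longrightarrow> lam U < z \<Longrightarrow> l U + k > 0"
    and shock_speed: "rankine_hugoniot F h UL US \<Longrightarrow> h < lam UL \<Longrightarrow> h < z"
    and fan_end: "\<And>U x. centered_fan F lam D U h x \<Longrightarrow> h < x \<Longrightarrow> U x = US \<Longrightarrow> x \<le> z"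
    and const: "UL = US \<Longrightarrow> lam US < z"
  shows "h < z \<and> wave_potential F l k h UL < wave_potential F l k z US"
proof -
  from wave consider
    (shock) "rankine_hugoniot F h UL US" "lam US < h" "h < lam UL"
    | (fan) x U where "lam UL = h" "centered_fan F lam D U h x" "U h = UL" "U x = US"
    unfolding left_wave_def left_fan_def by blast
  then show ?thesis
  proof cases
    case shock
    then have "h < z" using shock_speed by blast
    moreover have "l US + k > 0" using pos D shock \<open>h < z\<close> by auto
    ultimately show ?thesis
      using wave_potential_shock[OF bounded_linear.linear[OF l] shock(1), of k]
        wave_potential_strict_mono[of h z l US k F] by auto
  next
    case fan
    show ?thesis
    proof (cases "h < x")
      case True
      then have xz: "x \<le> z" using fan_end fan by blast
      have "wave_potential F l k h (U h) < wave_potential F l k x (U x)"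
      proof (rule wave_potential_fan[OF l fan(2) True])
        fix \<xi> assume "h < \<xi>" "\<xi> < x"
        then have "U \<xi> \<in> D" "lam (U \<xi>) = \<xi>" using fan(2) unfolding centered_fan_def by auto
        then show "l (U \<xi>) + k > 0" using pos xz \<open>\<xi> < x\<close> by auto
      qed
      also have "\<dots> \<le> wave_potential F l k z (U x)"
        unfolding fan(4) using nonneg[OF D(2)] by (rule wave_potential_mono[OF xz])
      finally show ?thesis using fan True xz by simp
    next
      case False
      then have "h = x" using fan(2) unfolding centered_fan_def by auto
      then have "UL = US" using fan by simp
      then have "h < z" "l US + k > 0" using const fan pos D by auto
      then show ?thesis using \<open>UL = US\<close> wave_potential_strict_mono by blast
    qed
  qed
qed

subsection \<open>Mirror symmetry\<close>

text \<open>\<open>R\<close> describes the effect of \<open>x \<mapsto> - x\<close> on states; it maps the family of speed \<open>lamR\<close> to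
  that of speed \<open>lamL\<close>.\<close>

definition mirror_symmetric ::
    "('a::real_normed_vector \<Rightarrow> 'a) \<Rightarrow> ('a \<Rightarrow> 'a) \<Rightarrow> ('a \<Rightarrow> real) \<Rightarrow> ('a \<Rightarrow> real) \<Rightarrow> 'a set \<Rightarrow> bool" where
  "mirror_symmetric R F lamR lamL D \<longleftrightarrow> bounded_linear R \<and>
     (\<forall>U. F (R U) = - R (F U)) \<and> (\<forall>U. lamL (R U) = - lamR U) \<and> (\<forall>U\<in>D. R U \<in> D)"

lemma centered_fan_mirror:
  assumes R: "mirror_symmetric R F lamR lamL D"
    and fan: "centered_fan F lamR D U x h"
  shows "centered_fan F lamL D (\<lambda>\<xi>. R (U (- \<xi>))) (- h) (- x)"
proof -
  have bl: "bounded_linear R" and FR: "\<And>U. F (R U) = - R (F U)"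
    and lR: "\<And>U. lamL (R U) = - lamR U" and DR: "\<And>U. U \<in> D \<Longrightarrow> R U \<in> D"
    using R unfolding mirror_symmetric_def by auto
  have cont: "continuous_on {- h..- x} (\<lambda>\<xi>. f (- \<xi>))" if "continuous_on {x..h} f" for f :: "real \<Rightarrow> 'a"
    by (rule continuous_on_compose2[OF that]) (auto intro: continuous_intros)
  show ?thesis
    unfolding centered_fan_def
  proof (intro conjI ballI)
    show "- h \<le> - x" using fan by (simp add: centered_fan_def)
    show "continuous_on {- h..- x} (\<lambda>\<xi>. R (U (- \<xi>)))"
      using fan bounded_linear.continuous_on[OF bl cont] by (auto simp: centered_fan_def)
    show "continuous_on {- h..- x} (\<lambda>\<xi>. F (R (U (- \<xi>))))"
      unfolding FR using fan bounded_linear.continuous_on[OF bl cont[of "\<lambda>\<xi>. F (U \<xi>)"]]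
      by (auto simp: centered_fan_def intro: continuous_on_minus)
    fix \<xi> assume "\<xi> \<in> {- h<..<- x}"
    then have \<xi>: "- \<xi> \<in> {x<..<h}" by auto
    then show "R (U (- \<xi>)) \<in> D" "lamL (R (U (- \<xi>))) = \<xi>"
      using fan DR lR by (auto simp: centered_fan_def)
    obtain U' where U': "(U has_vector_derivative U') (at (- \<xi>))"
      "((\<lambda>\<xi>. F (U \<xi>)) has_vector_derivative ((- \<xi>) *\<^sub>R U')) (at (- \<xi>))"
      using fan \<xi> unfolding centered_fan_def by blast
    have chain: "((\<lambda>\<xi>. f (- \<xi>)) has_vector_derivative - f') (at \<xi>)"
      if "(f has_vector_derivative f') (at (- \<xi>))" for f :: "real \<Rightarrow> 'a" and f'
    proof -
      have "(uminus has_vector_derivative -1) (at \<xi>)"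
        by (auto intro!: derivative_eq_intros)
      from vector_diff_chain_at[OF this that] show ?thesis by (simp add: o_def)
    qed
    have 1: "((\<lambda>\<xi>. R (U (- \<xi>))) has_vector_derivative R (- U')) (at \<xi>)"
      by (rule bounded_linear.has_vector_derivative[OF bl chain[OF U'(1)]])
    have "((\<lambda>\<xi>. R (F (U (- \<xi>)))) has_vector_derivative R (\<xi> *\<^sub>R U')) (at \<xi>)"
      using bounded_linear.has_vector_derivative[OF bl chain[OF U'(2)]] by simp
    then have "((\<lambda>\<xi>. - R (F (U (- \<xi>)))) has_vector_derivative - R (\<xi> *\<^sub>R U')) (at \<xi>)"
      by (rule has_vector_derivative_minus)
    moreover have "- R (\<xi> *\<^sub>R U') = \<xi> *\<^sub>R R (- U')"
      using bounded_linear.linear[OF bl] by (simp add: linear_scale linear_neg)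
    ultimately show "\<exists>U'. ((\<lambda>\<xi>. R (U (- \<xi>))) has_vector_derivative U') (at \<xi>) \<and>
        ((\<lambda>\<xi>. F (R (U (- \<xi>)))) has_vector_derivative \<xi> *\<^sub>R U') (at \<xi>)"
      unfolding FR using 1 by auto
  qed
qed

text \<open>The reflection \<open>x \<mapsto> - x\<close> reverses the order of the edges and the signs of all speeds.\<close>

lemma right_fan_mirror:
  assumes "mirror_symmetric R F lamR lamL D" and "right_fan F lamR D US UR x h"
  shows "left_fan F lamL D (R UR) (R US) (- h) (- x)"
proof -
  obtain U where "lamR UR = h" "centered_fan F lamR D U x h" "U x = US" "U h = UR"
    using assms(2) unfolding right_fan_def by blast
  then show ?thesis
    using centered_fan_mirror[OF assms(1), of U x h] assms(1)
    unfolding left_fan_def mirror_symmetric_def by fastforce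
qed

lemma right_wave_mirror:
  assumes R: "mirror_symmetric R F lamR lamL D" and "right_wave F lamR D US UR h"
  shows "left_wave F lamL D (R UR) (R US) (- h)"
proof -
  have "left_wave F lamL D (R UR) (R US) (- h)"
    if *: "rankine_hugoniot F h US UR" "lamR UR < h" "h < lamR US"
  proof -
    have lin: "linear R" and FR: "\<And>U. F (R U) = - R (F U)" and lR: "\<And>U. lamL (R U) = - lamR U"
      using R unfolding mirror_symmetric_def by (auto intro: bounded_linear.linear)
    have "R (F UR) - R (F US) = h *\<^sub>R (R UR - R US)"
      using arg_cong[OF *(1)[unfolded rankine_hugoniot_def], of R]
    by (simp add: linear_diff[OF lin] linear_scale[OF lin])
    then have "rankine_hugoniot F (- h) (R UR) (R US)"
      unfolding rankine_hugoniot_def FR by (simp add: algebra_simps)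
    then show ?thesis using * lR unfolding left_wave_def by auto
  qed
  moreover have "left_wave F lamL D (R UR) (R US) (- h)" if "right_fan F lamR D US UR x h" for x
    using right_fan_mirror[OF R that] unfolding left_wave_def by (intro disjI2 exI)
  ultimately show ?thesis
    using assms(2) unfolding right_wave_def by (elim disjE exE conjE) simp_all
qed

lemma wave_potential_mirror:
  assumes R: "mirror_symmetric R F lamR lamL D" and l: "linear l"
  shows "wave_potential F l k (- \<xi>) (R U) = - wave_potential F (\<lambda>U. l (R U)) k \<xi> U"
proof -
  have "F (R U) = - R (F U)" using R unfolding mirror_symmetric_def by blast
  then show ?thesis
    unfolding wave_potential_def using linear_neg[OF l, of "R (F U)"] by simp
qed


section \<open>The extended Euler system\<close>

lemma ext_states_iff:
  "(\<rho>, q, E, R, G) \<in> ext_states b \<longleftrightarrow>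
     \<rho> > 0 \<and> 1 - b * \<rho> > 0 \<and> E / \<rho> - (q / \<rho>)\<^sup>2 / 2 > 0 \<and> G > \<rho>"
  by (auto simp: ext_states_def ext_internal_def)

text \<open>All functionals needed for the extended Euler system: \<open>\<alpha> = 0\<close> for density, covolume and
  (with \<open>w\<close> the radiation energy per unit mass) radiation energy, and \<open>\<alpha> = 1\<close> for the energy in a
  moving frame.\<close>

definition ext_functional :: "real \<Rightarrow> real \<Rightarrow> real \<Rightarrow> ext_state \<Rightarrow> real" where
  "ext_functional \<alpha> \<beta> w U = (case U of (\<rho>, q, E, R, G) \<Rightarrow> \<alpha> * E - \<beta> * q + w * \<rho>)"

definition ext_mirror :: "ext_state \<Rightarrow> ext_state" where
  "ext_mirror U = (case U of (\<rho>, q, E, R, G) \<Rightarrow> (\<rho>, - q, E, R, G))"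

lemma linear_ext_functional: "linear (ext_functional \<alpha> \<beta> w)"
  by (rule linearI) (auto simp: ext_functional_def algebra_simps split: prod.split)

lemma bounded_linear_ext_functional: "bounded_linear (ext_functional \<alpha> \<beta> w)"
  using linear_ext_functional linear_conv_bounded_linear by blast

lemma ext_functional_0 [simp]: "ext_functional \<alpha> \<beta> w 0 = 0"
  using linear_0[OF linear_ext_functional] .

lemma ext_flux_0 [simp]: "ext_flux b 0 = 0"
  by (simp add: ext_flux_def zero_prod_def ext_vel_def ext_pressure_def Let_def)

lemma ext_mirror_0 [simp]: "ext_mirror 0 = 0"
  by (simp add: ext_mirror_def zero_prod_def)

lemma ext_functional_mirror: "ext_functional \<alpha> \<beta> w (ext_mirror U) = ext_functional \<alpha> (- \<beta>) w U"
  by (simp add: ext_functional_def ext_mirror_def split: prod.split)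

lemma ext_vel_mirror: "ext_vel (ext_mirror U) = - ext_vel U"
  by (simp add: ext_vel_def ext_mirror_def split: prod.split)

lemma ext_mirror_in_states: "U \<in> ext_states b \<Longrightarrow> ext_mirror U \<in> ext_states b"
  by (cases U) (simp add: ext_states_iff ext_mirror_def)

lemma mirror_symmetric_ext:
  "mirror_symmetric ext_mirror (ext_flux b)
     (\<lambda>U. ext_vel U + ext_sound b U) (\<lambda>U. ext_vel U - ext_sound b U) (ext_states b)"
proof -
  have "linear ext_mirror"
    by (rule linearI) (auto simp: ext_mirror_def split: prod.split)
  then have "bounded_linear ext_mirror"
    using linear_conv_bounded_linear by blast
  moreover have "ext_flux b (ext_mirror U) = - ext_mirror (ext_flux b U)" for U
    by (cases U) (simp add: ext_flux_def ext_mirror_def ext_vel_def ext_pressure_def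
        ext_internal_def Let_def)
  moreover have "ext_sound b (ext_mirror U) = ext_sound b U" for U
    by (cases U) (simp add: ext_sound_def ext_mirror_def ext_pressure_def ext_internal_def)
  ultimately show ?thesis
    unfolding mirror_symmetric_def by (simp add: ext_vel_mirror ext_mirror_in_states)
qed

lemma ext_sound_pos: "U \<in> ext_states b \<Longrightarrow> ext_sound b U > 0"
  by (cases U) (simp add: ext_states_iff ext_sound_def ext_pressure_def ext_internal_def)

lemma continuous_nonneg_right_end:
  fixes f :: "real \<Rightarrow> real"
  assumes "continuous_on {a..b} f" and "a < b" and "\<And>\<xi>. a < \<xi> \<Longrightarrow> \<xi> < b \<Longrightarrow> 0 \<le> f \<xi>"
  shows "0 \<le> f b"
  using continuous_ge_on_closure[of "{a<..<b}" f b 0] assms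
  by (simp add: closure_greaterThanLessThan)

text \<open>The mass flux relative to the wave determines the position of the contact: it is positive ahead
  of a left shock and conserved across it, and in a fan the fluid is faster than the wave by the
  sound speed. The bound is proved for \<open>\<rho>v - \<xi>\<rho> \<ge> 0\<close>, which passes to the end of the fan by
  continuity of \<open>U\<close>.\<close>

lemma ext_left_wave_gain:
  assumes wave: "left_wave (ext_flux b) (\<lambda>U. ext_vel U - ext_sound b U) (ext_states b) UL US h"
    and D: "UL \<in> ext_states b" "US \<in> ext_states b"
    and pos: "\<And>U. U \<in> ext_states b \<Longrightarrow> ext_functional \<alpha> \<beta> w U + k > 0"
  shows "h < ext_vel US \<and>
    wave_potential (ext_flux b) (ext_functional \<alpha> \<beta> w) k h UL
      < wave_potential (ext_flux b) (ext_functional \<alpha> \<beta> w) k (ext_vel US) US"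
proof (rule left_wave_gain[OF bounded_linear_ext_functional wave D])
  show "0 \<le> ext_functional \<alpha> \<beta> w U + k" if "U \<in> ext_states b" for U
    using pos[OF that] by simp
  show "0 < ext_functional \<alpha> \<beta> w U + k" if "U \<in> ext_states b" for U
    using pos[OF that] .
  show "ext_vel US - ext_sound b US < ext_vel US"
    using ext_sound_pos[OF D(2)] by simp
next
  assume rh: "rankine_hugoniot (ext_flux b) h UL US" and lax: "h < ext_vel UL - ext_sound b UL"
  obtain \<rho>L qL EL RL GL where UL: "UL = (\<rho>L, qL, EL, RL, GL)" by (cases UL)
  obtain \<rho>S qS ES RS GS where US: "US = (\<rho>S, qS, ES, RS, GS)" by (cases US)
  have "\<rho>S * ext_vel US - \<rho>L * ext_vel UL = h * (\<rho>S - \<rho>L)"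
    using rh by (simp add: rankine_hugoniot_def UL US ext_flux_def Let_def)
  then have "\<rho>S * (ext_vel US - h) = \<rho>L * (ext_vel UL - h)"
    by (simp add: algebra_simps)
  moreover have "\<rho>L > 0" "\<rho>S > 0" using D by (auto simp: UL US ext_states_iff)
  moreover have "ext_vel UL - h > 0" using lax ext_sound_pos[OF D(1)] by simp
  ultimately have "ext_vel US - h > 0" by (metis mult_pos_pos zero_less_mult_pos)
  then show "h < ext_vel US" by simp
next
  fix U x
  assume fan: "centered_fan (ext_flux b) (\<lambda>U. ext_vel U - ext_sound b U) (ext_states b) U h x"
    and "h < x" and xS: "U x = US"
  have "0 \<le> fst (snd (U x)) - x * fst (U x)"
  proof (rule continuous_nonneg_right_end[OF _ \<open>h < x\<close>])
    show "continuous_on {h..x} (\<lambda>\<xi>. fst (snd (U \<xi>)) - \<xi> * fst (U \<xi>))"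
      using fan unfolding centered_fan_def by (intro continuous_intros) auto
    fix \<xi> assume "h < \<xi>" "\<xi> < x"
    then have U: "U \<xi> \<in> ext_states b" "ext_vel (U \<xi>) - ext_sound b (U \<xi>) = \<xi>"
      using fan unfolding centered_fan_def by auto
    then have "\<xi> < ext_vel (U \<xi>)" using ext_sound_pos[OF U(1)] by simp
    then show "0 \<le> fst (snd (U \<xi>)) - \<xi> * fst (U \<xi>)"
      using U(1) by (cases "U \<xi>") (simp add: ext_states_iff ext_vel_def field_simps)
  qed
  then show "x \<le> ext_vel US"
    using D(2) unfolding xS[symmetric] by (cases "U x") (simp add: ext_states_iff ext_vel_def field_simps)
qed

lemma ext_right_wave_gain:
  assumes wave: "right_wave (ext_flux b) (\<lambda>U. ext_vel U + ext_sound b U) (ext_states b) US UR h"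
    and D: "US \<in> ext_states b" "UR \<in> ext_states b"
    and pos: "\<And>U. U \<in> ext_states b \<Longrightarrow> ext_functional \<alpha> \<beta> w U + k > 0"
  shows "ext_vel US < h \<and>
    wave_potential (ext_flux b) (ext_functional \<alpha> \<beta> w) k (ext_vel US) US
      < wave_potential (ext_flux b) (ext_functional \<alpha> \<beta> w) k h UR"
proof -
  have pos': "ext_functional \<alpha> (- \<beta>) w U + k > 0" if "U \<in> ext_states b" for U
    using pos[OF ext_mirror_in_states[OF that]] by (simp add: ext_functional_mirror)
  have eq: "wave_potential (ext_flux b) (ext_functional \<alpha> (- \<beta>) w) k (- \<xi>) (ext_mirror U)
      = - wave_potential (ext_flux b) (ext_functional \<alpha> \<beta> w) k \<xi> U" for \<xi> U
    using wave_potential_mirror[OF mirror_symmetric_ext linear_ext_functional,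
        of b \<alpha> "- \<beta>" w k \<xi> U]
    by (simp add: ext_functional_mirror)
  from ext_left_wave_gain[OF right_wave_mirror[OF mirror_symmetric_ext wave]
      ext_mirror_in_states[OF D(2)] ext_mirror_in_states[OF D(1)] pos']
  show ?thesis
    by (simp add: ext_vel_mirror eq)
qed

text \<open>A fan that ends in vacuum cannot be degenerate, since its datum has positive density. At vacuum
  the potential is \<open>x k\<close>, for every functional.\<close>

lemma ext_left_vacuum_gain:
  assumes fan: "left_fan (ext_flux b) (\<lambda>U. ext_vel U - ext_sound b U) (ext_states b) UL 0 h x"
    and D: "UL \<in> ext_states b"
    and pos: "\<And>U. U \<in> ext_states b \<Longrightarrow> ext_functional \<alpha> \<beta> w U + k > 0"
  shows "h < x \<and> wave_potential (ext_flux b) (ext_functional \<alpha> \<beta> w) k h UL < x * k"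
proof -
  obtain U where U: "U h = UL" "U x = 0"
    "centered_fan (ext_flux b) (\<lambda>U. ext_vel U - ext_sound b U) (ext_states b) U h x"
    using fan unfolding left_fan_def by blast
  have "UL \<noteq> 0" using D by (auto simp: zero_prod_def ext_states_iff)
  then have "h \<noteq> x" using U by auto
  then have "h < x" using U(3) unfolding centered_fan_def by simp
  moreover have "ext_functional \<alpha> \<beta> w (U \<xi>) + k > 0" if "h < \<xi>" "\<xi> < x" for \<xi>
    using U(3) that unfolding centered_fan_def by (intro pos) auto
  ultimately show ?thesis
    using wave_potential_fan[OF bounded_linear_ext_functional U(3), of \<alpha> \<beta> w k] U(1,2)
    by (simp add: wave_potential_def)
qed

lemma ext_right_vacuum_gain:
  assumes fan: "right_fan (ext_flux b) (\<lambda>U. ext_vel U + ext_sound b U) (ext_states b) 0 UR x h"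
    and D: "UR \<in> ext_states b"
    and pos: "\<And>U. U \<in> ext_states b \<Longrightarrow> ext_functional \<alpha> \<beta> w U + k > 0"
  shows "x < h \<and> x * k < wave_potential (ext_flux b) (ext_functional \<alpha> \<beta> w) k h UR"
proof -
  have pos': "ext_functional \<alpha> (- \<beta>) w U + k > 0" if "U \<in> ext_states b" for U
    using pos[OF ext_mirror_in_states[OF that]] by (simp add: ext_functional_mirror)
  have eq: "wave_potential (ext_flux b) (ext_functional \<alpha> (- \<beta>) w) k (- h) (ext_mirror UR)
      = - wave_potential (ext_flux b) (ext_functional \<alpha> \<beta> w) k h UR"
    using wave_potential_mirror[OF mirror_symmetric_ext linear_ext_functional,
        of b \<alpha> "- \<beta>" w k h UR]
    by (simp add: ext_functional_mirror)
  from ext_left_vacuum_gain[OF right_fan_mirror[OF mirror_symmetric_ext fan, simplified]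
      ext_mirror_in_states[OF D] pos']
  show ?thesis
    by (simp add: eq)
qed

text \<open>Mass does not cross a curve that moves with the fluid, so the potential there is insensitive to
  multiples of the density.\<close>

lemma ext_potential_at_fluid_velocity:
  assumes "U \<in> ext_states b"
  shows "wave_potential (ext_flux b) (ext_functional \<alpha> \<beta> w) k (ext_vel U) U
       = wave_potential (ext_flux b) (ext_functional \<alpha> \<beta> w') k (ext_vel U) U"
  by (cases U) (simp add: wave_potential_def ext_functional_def ext_flux_def Let_def algebra_simps)

lemma ext_contact_velocity:
  assumes "US \<in> ext_states b" "UT \<in> ext_states b"
    and "rankine_hugoniot (ext_flux b) (ext_vel US) US UT"
  shows "ext_vel UT = ext_vel US"
proof -
  obtain \<rho>S qS ES RS GS where US: "US = (\<rho>S, qS, ES, RS, GS)" by (cases US)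
  obtain \<rho>T qT ET RT GT where UT: "UT = (\<rho>T, qT, ET, RT, GT)" by (cases UT)
  have "\<rho>T * ext_vel UT - \<rho>S * ext_vel US = ext_vel US * (\<rho>T - \<rho>S)"
    using assms(3) by (simp add: rankine_hugoniot_def US UT ext_flux_def Let_def)
  then have "\<rho>T * (ext_vel UT - ext_vel US) = 0"
    by (simp add: algebra_simps)
  then show ?thesis using assms(2) by (simp add: UT ext_states_iff)
qed

text \<open>The left-hand side of the second inequality is \<open>2 s\<close> times the value of the functional at the bar
  state, with the weight \<open>wL\<close> of the density used left of the contact and \<open>wR\<close> right of it. In the
  vacuum case the potential grows like \<open>\<xi> k\<close> between the fans, whence \<open>k \<ge> 0\<close>.\<close>

lemma ext_riemann_average_pos:
  assumes bound: "max_wave_speed_bound (ext_riemann b UL UR) s"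
    and posL: "\<And>U. U \<in> ext_states b \<Longrightarrow> ext_functional \<alpha> \<beta> wL U + k > 0"
    and posR: "\<And>U. U \<in> ext_states b \<Longrightarrow> ext_functional \<alpha> \<beta> wR U + k > 0"
    and "k \<ge> 0"
  shows "s > 0 \<and>
    s * (ext_functional \<alpha> \<beta> wL UL + k) + s * (ext_functional \<alpha> \<beta> wR UR + k)
      - (ext_functional \<alpha> \<beta> wR (ext_flux b UR) - ext_functional \<alpha> \<beta> wL (ext_flux b UL)) > 0"
proof -
  let ?W = "\<lambda>w. wave_potential (ext_flux b) (ext_functional \<alpha> \<beta> w) k"
  obtain hL hR where rp: "ext_riemann b UL UR hL hR" and h: "- s \<le> hL" "hR \<le> s"
    using bound unfolding max_wave_speed_bound_def by auto
  have D: "UL \<in> ext_states b" "UR \<in> ext_states b"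
    using rp unfolding ext_riemann_def Let_def by auto
  have "hL < hR \<and> ?W wL hL UL < ?W wR hR UR"
  proof -
    from rp consider
      (contact) US UT where "US \<in> ext_states b" "UT \<in> ext_states b"
        "left_wave (ext_flux b) (\<lambda>U. ext_vel U - ext_sound b U) (ext_states b) UL US hL"
        "rankine_hugoniot (ext_flux b) (ext_vel US) US UT"
        "right_wave (ext_flux b) (\<lambda>U. ext_vel U + ext_sound b U) (ext_states b) UT UR hR"
      | (vacuum) xL xR where
        "left_fan (ext_flux b) (\<lambda>U. ext_vel U - ext_sound b U) (ext_states b) UL 0 hL xL"
        "xL \<le> xR"
        "right_fan (ext_flux b) (\<lambda>U. ext_vel U + ext_sound b U) (ext_states b) 0 UR xR hR"
      unfolding ext_riemann_def Let_def by blast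
    then show ?thesis
    proof cases
      case contact
      have v: "ext_vel UT = ext_vel US"
        by (rule ext_contact_velocity[OF contact(1,2,4)])
      have L: "hL < ext_vel US" "?W wL hL UL < ?W wL (ext_vel US) US"
        using ext_left_wave_gain[OF contact(3) D(1) contact(1) posL] by auto
      have R: "ext_vel US < hR" "?W wR (ext_vel US) UT < ?W wR hR UR"
        using ext_right_wave_gain[OF contact(5) contact(2) D(2) posR] v by auto
      have "?W wL (ext_vel US) US = ?W wL (ext_vel US) UT"
        by (rule wave_potential_shock[OF linear_ext_functional contact(4)])
      also have "\<dots> = ?W wR (ext_vel US) UT"
        using ext_potential_at_fluid_velocity[OF contact(2)] v by metis
      finally show ?thesis using L R by simp
    next
      case vacuum
      have "hL < xL" "?W wL hL UL < xL * k"
        using ext_left_vacuum_gain[OF vacuum(1) D(1) posL] by auto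
      moreover have "xR < hR" "xR * k < ?W wR hR UR"
        using ext_right_vacuum_gain[OF vacuum(3) D(2) posR] by auto
      moreover have "xL * k \<le> xR * k" using vacuum(2) \<open>k \<ge> 0\<close> by (simp add: mult_right_mono)
      ultimately show ?thesis using vacuum(2) by linarith
    qed
  qed
  moreover have "?W wL (- s) UL \<le> ?W wL hL UL"
    by (rule wave_potential_mono[OF h(1)]) (use posL[OF D(1)] in simp)
  moreover have "?W wR hR UR \<le> ?W wR s UR"
    by (rule wave_potential_mono[OF h(2)]) (use posR[OF D(2)] in simp)
  ultimately have "hL < hR" "?W wL (- s) UL < ?W wR s UR" by auto
  then show ?thesis
    using h unfolding wave_potential_def by (simp add: algebra_simps)
qed


section \<open>The radiation pressure system\<close>

lemma rad1_states_iff: "(\<rho>, q, E) \<in> rad1_states \<longleftrightarrow> \<rho> > 0 \<and> rad1_pressure (\<rho>, q, E) \<ge> 0"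
  by (auto simp: rad1_states_def)

text \<open>For \<open>w = 0\<close>, the energy in the frame moving with velocity \<open>t\<close>; \<open>w\<close> accounts for transverse kinetic energy.\<close>

definition rad1_functional :: "real \<Rightarrow> real \<Rightarrow> rad1_state \<Rightarrow> real" where
  "rad1_functional t w W = (case W of (\<rho>, q, E) \<Rightarrow> E - t * q + (t\<^sup>2 / 2 + w) * \<rho>)"

definition rad1_mirror :: "rad1_state \<Rightarrow> rad1_state" where
  "rad1_mirror W = (case W of (\<rho>, q, E) \<Rightarrow> (\<rho>, - q, E))"

lemma linear_rad1_functional: "linear (rad1_functional t w)"
  by (rule linearI) (auto simp: rad1_functional_def algebra_simps split: prod.split)

lemma bounded_linear_rad1_functional: "bounded_linear (rad1_functional t w)"
  using linear_rad1_functional linear_conv_bounded_linear by blast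

lemma rad1_functional_mirror: "rad1_functional t w (rad1_mirror W) = rad1_functional (- t) w W"
  by (simp add: rad1_functional_def rad1_mirror_def split: prod.split)

lemma rad1_mirror_in_states: "W \<in> rad1_states \<Longrightarrow> rad1_mirror W \<in> rad1_states"
  by (cases W) (simp add: rad1_states_iff rad1_mirror_def rad1_pressure_def)

lemma rad1_pressure_mirror: "rad1_pressure (rad1_mirror W) = rad1_pressure W"
  by (cases W) (simp add: rad1_mirror_def rad1_pressure_def)

lemma mirror_symmetric_rad1:
  "mirror_symmetric rad1_mirror rad1_flux rad1_speed (\<lambda>W. - rad1_speed W) rad1_states"
proof -
  have "linear rad1_mirror"
    by (rule linearI) (auto simp: rad1_mirror_def split: prod.split)
  then have "bounded_linear rad1_mirror"
    using linear_conv_bounded_linear by blast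
  moreover have "rad1_flux (rad1_mirror W) = - rad1_mirror (rad1_flux W)" for W
    unfolding rad1_flux_def rad1_pressure_mirror
    by (cases W) (simp add: rad1_mirror_def rad1_vel_def)
  moreover have "rad1_speed (rad1_mirror W) = rad1_speed W" for W
    by (cases W) (simp add: rad1_speed_def rad1_mirror_def rad1_pressure_def)
  ultimately show ?thesis
    unfolding mirror_symmetric_def by (simp add: rad1_mirror_in_states)
qed

lemma rad1_functional_eq:
  assumes "\<rho> > 0"
  shows "rad1_functional t w (\<rho>, q, E) = 3 * rad1_pressure (\<rho>, q, E) + \<rho> * ((q / \<rho> - t)\<^sup>2 / 2 + w)"
  using assms by (simp add: rad1_functional_def rad1_pressure_def power2_eq_square field_simps)

lemma rad1_functional_nonneg:
  assumes "W \<in> rad1_states" and "w \<ge> 0"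
  shows "3 * rad1_pressure W \<le> rad1_functional t w W"
  using assms by (cases W) (simp add: rad1_states_iff rad1_functional_eq)

lemma rad1_speed_pos_iff: "W \<in> rad1_states \<Longrightarrow> rad1_speed W > 0 \<longleftrightarrow> rad1_pressure W > 0"
  by (cases W) (auto simp: rad1_states_iff rad1_speed_def zero_less_divide_iff)

lemma rad1_speed_nonneg: "W \<in> rad1_states \<Longrightarrow> rad1_speed W \<ge> 0"
  by (cases W) (auto simp: rad1_states_iff rad1_speed_def)

text \<open>The contact is stationary and left waves have nonpositive characteristic speed. A state with
  negative characteristic speed has positive pressure, and hence a positive functional.\<close>

lemma rad1_left_wave_gain:
  assumes wave: "left_wave rad1_flux (\<lambda>W. - rad1_speed W) rad1_states WL WS h"
    and D: "WL \<in> rad1_states" "WS \<in> rad1_states" and pL: "rad1_pressure WL > 0" and "w \<ge> 0"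
  shows "h < 0 \<and>
    wave_potential rad1_flux (rad1_functional t w) 0 h WL
      < wave_potential rad1_flux (rad1_functional t w) 0 0 WS"
proof (rule left_wave_gain[OF bounded_linear_rad1_functional wave D])
  fix W assume W: "W \<in> rad1_states"
  then have "rad1_pressure W \<ge> 0" by (cases W) (simp add: rad1_states_iff)
  then show "0 \<le> rad1_functional t w W + 0"
    using rad1_functional_nonneg[OF W \<open>w \<ge> 0\<close>, of t] by simp
  assume "- rad1_speed W < 0"
  then show "0 < rad1_functional t w W + 0"
    using rad1_functional_nonneg[OF W \<open>w \<ge> 0\<close>, of t] rad1_speed_pos_iff[OF W] by simp
next
  show "h < 0" if "h < - rad1_speed WL"
    using that rad1_speed_nonneg[OF D(1)] by simp
  show "- rad1_speed WS < 0" if "WL = WS"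
    using that pL rad1_speed_pos_iff[OF D(1)] by simp
next
  fix U x
  assume fan: "centered_fan rad1_flux (\<lambda>W. - rad1_speed W) rad1_states U h x" and "h < x"
  have "\<xi> \<le> 0" if "h < \<xi>" "\<xi> < x" for \<xi>
  proof -
    have "U \<xi> \<in> rad1_states" "- rad1_speed (U \<xi>) = \<xi>"
      using fan that unfolding centered_fan_def by auto
    then show ?thesis using rad1_speed_nonneg[of "U \<xi>"] by simp
  qed
  then show "x \<le> 0"
    using \<open>h < x\<close> by (rule_tac dense_le_bounded[of h x]) auto
qed

lemma rad1_right_wave_gain:
  assumes wave: "right_wave rad1_flux rad1_speed rad1_states WS WR h"
    and D: "WS \<in> rad1_states" "WR \<in> rad1_states" and pR: "rad1_pressure WR > 0" and "w \<ge> 0"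
  shows "0 < h \<and>
    wave_potential rad1_flux (rad1_functional t w) 0 0 WS
      < wave_potential rad1_flux (rad1_functional t w) 0 h WR"
proof -
  have eq: "wave_potential rad1_flux (rad1_functional (- t) w) 0 (- \<xi>) (rad1_mirror W)
      = - wave_potential rad1_flux (rad1_functional t w) 0 \<xi> W" for \<xi> W
    using wave_potential_mirror[OF mirror_symmetric_rad1 linear_rad1_functional,
        of "- t" w 0 \<xi> W]
    by (simp add: rad1_functional_mirror)
  have "rad1_pressure (rad1_mirror WR) > 0" using pR by (simp add: rad1_pressure_mirror)
  from rad1_left_wave_gain[OF right_wave_mirror[OF mirror_symmetric_rad1 wave]
      rad1_mirror_in_states[OF D(2)] rad1_mirror_in_states[OF D(1)] this \<open>w \<ge> 0\<close>, of "- t"]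
  show ?thesis
    using eq[of h WR] eq[of 0 WS] by simp
qed

text \<open>The flux of the density is zero, so at \<open>\<xi> = 0\<close> the potential does not depend on the weight of the
  density.\<close>

lemma rad1_riemann_average_pos:
  assumes bound: "max_wave_speed_bound (rad1_riemann WL WR) s"
    and p: "rad1_pressure WL > 0" "rad1_pressure WR > 0" and w: "wL \<ge> 0" "wR \<ge> 0"
  shows "s > 0 \<and>
    s * rad1_functional t wL WL + s * rad1_functional t wR WR
      - (rad1_functional t wR (rad1_flux WR) - rad1_functional t wL (rad1_flux WL)) > 0"
proof -
  let ?W = "\<lambda>w. wave_potential rad1_flux (rad1_functional t w) 0"
  obtain hL hR where rp: "rad1_riemann WL WR hL hR" and h: "- s \<le> hL" "hR \<le> s"
    using bound unfolding max_wave_speed_bound_def by auto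
  have D: "WL \<in> rad1_states" "WR \<in> rad1_states"
    using rp unfolding rad1_riemann_def Let_def by auto
  obtain WS WT where S: "WS \<in> rad1_states" "WT \<in> rad1_states"
    "left_wave rad1_flux (\<lambda>W. - rad1_speed W) rad1_states WL WS hL"
    "rankine_hugoniot rad1_flux 0 WS WT"
    "right_wave rad1_flux rad1_speed rad1_states WT WR hR"
    using rp unfolding rad1_riemann_def Let_def by blast
  have L: "hL < 0" "?W wL hL WL < ?W wL 0 WS"
    using rad1_left_wave_gain[OF S(3) D(1) S(1) p(1) w(1)] by auto
  have R: "0 < hR" "?W wR 0 WT < ?W wR hR WR"
    using rad1_right_wave_gain[OF S(5) S(2) D(2) p(2) w(2)] by auto
  have "?W wL 0 WS = ?W wL 0 WT"
    by (rule wave_potential_shock[OF linear_rad1_functional S(4)])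
  also have "\<dots> = ?W wR 0 WT"
    by (simp add: wave_potential_def rad1_functional_def rad1_flux_def)
  finally have "?W wL hL WL < ?W wR hR WR" using L R by simp
  moreover have "?W wL (- s) WL \<le> ?W wL hL WL"
    by (rule wave_potential_mono[OF h(1)]) (use rad1_functional_nonneg[OF D(1) w(1), of t] p(1) in simp)
  moreover have "?W wR hR WR \<le> ?W wR s WR"
    by (rule wave_potential_mono[OF h(2)]) (use rad1_functional_nonneg[OF D(2) w(2), of t] p(2) in simp)
  ultimately have "?W wL (- s) WL < ?W wR s WR" by auto
  then show ?thesis
    using h L R unfolding wave_potential_def by simp
qed


section \<open>Reduction of the flux to one direction\<close>

lemma max_wave_speed_bound_mono:
  "max_wave_speed_bound rp s \<Longrightarrow> s \<le> s' \<Longrightarrow> max_wave_speed_bound rp s'"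
  unfolding max_wave_speed_bound_def by (meson order_trans)

definition energy_functional :: "real ^ 'd \<Rightarrow> 'd::finite state \<Rightarrow> real" where
  "energy_functional t u = Emech u - mom u \<bullet> t + dens u * (t \<bullet> t / 2)"

lemma linear_dens: "linear dens"
  by (rule linearI) (auto simp: dens_def split: prod.split)

lemma linear_mom: "linear mom"
  by (rule linearI) (auto simp: mom_def split: prod.split)

lemma linear_Erad: "linear Erad"
  by (rule linearI) (auto simp: Erad_def split: prod.split)

lemma linear_energy_functional: "linear (energy_functional t)"
  by (rule linearI)
    (auto simp: energy_functional_def Emech_def mom_def dens_def algebra_simps inner_add_left split: prod.split)

lemma mom_eq: "dens u \<noteq> 0 \<Longrightarrow> mom u = dens u *\<^sub>R vel u"
  by (simp add: vel_def)

text \<open>Completing the square in \<open>t\<close>: the energy is smallest in the frame of the fluid, where it is the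
  internal energy.\<close>

lemma energy_functional_eq:
  assumes "dens u > 0"
  shows "energy_functional t u = dens u * (internal u + (vel u - t) \<bullet> (vel u - t) / 2)"
proof -
  have "mom u = dens u *\<^sub>R vel u" using assms by (simp add: mom_eq)
  moreover have "Emech u = dens u * (internal u + vel u \<bullet> vel u / 2)"
    using assms by (simp add: internal_def power2_norm_eq_inner)
  ultimately show ?thesis
    by (simp add: energy_functional_def inner_diff_left inner_diff_right inner_commute field_simps)
qed

lemma internal_pos_iff:
  assumes "dens u > 0"
  shows "internal u > 0 \<longleftrightarrow> (\<forall>t. energy_functional t u > 0)"
proof
  assume "internal u > 0"
  then show "\<forall>t. energy_functional t u > 0"
    using assms by (auto simp: energy_functional_eq intro!: mult_pos_pos add_pos_nonneg)
next
  assume "\<forall>t. energy_functional t u > 0"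
  then have "energy_functional (vel u) u > 0" by blast
  then show "internal u > 0"
    using assms by (simp add: energy_functional_eq zero_less_mult_iff)
qed

text \<open>The kinetic energy per unit mass of the part of the velocity \<open>x\<close> that is orthogonal to the
  unit vector \<open>n\<close>.\<close>

definition transverse_energy :: "real ^ 'd::finite \<Rightarrow> real ^ 'd \<Rightarrow> real" where
  "transverse_energy n x = (x \<bullet> x - (x \<bullet> n)\<^sup>2) / 2"

lemma transverse_energy_nonneg: "norm n = 1 \<Longrightarrow> transverse_energy n x \<ge> 0"
  using Cauchy_Schwarz_ineq[of x n]
  by (simp add: transverse_energy_def dot_square_norm)

lemma ext_internal_data: "dens u \<noteq> 0 \<Longrightarrow> ext_internal (ext_data b p n u) = internal u"
  by (simp add: ext_internal_def ext_data_def internal_def mom_eq diff_divide_distrib)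

text \<open>\<open>\<Gamma>\<close> is chosen so that the covolume law of the extended system reproduces the given pressure at the
  data.\<close>

lemma ext_pressure_data:
  assumes "dens u \<noteq> 0" "1 - b * dens u \<noteq> 0" "internal u \<noteq> 0"
  shows "ext_pressure b (ext_data b p n u) = p u"
proof -
  have "ext_pressure b (ext_data b p n u)
      = (Gam b p u - dens u) / (1 - b * dens u) * ext_internal (ext_data b p n u)"
    by (simp add: ext_pressure_def ext_data_def)
  then show ?thesis
    using assms by (simp add: ext_internal_data Gam_def)
qed

lemma ext_vel_data: "dens u \<noteq> 0 \<Longrightarrow> ext_vel (ext_data b p n u) = vel u \<bullet> n"
  by (simp add: ext_vel_def ext_data_def mom_eq)

lemma ext_flux_data:
  assumes "dens u \<noteq> 0" "1 - b * dens u \<noteq> 0" "internal u \<noteq> 0"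
  shows "ext_flux b (ext_data b p n u) =
    (dens u * (vel u \<bullet> n), dens u * (vel u \<bullet> n)\<^sup>2 + p u,
     (vel u \<bullet> n) * (Emech u - dens u / 2 * ((norm (vel u))\<^sup>2 - (vel u \<bullet> n)\<^sup>2) + p u),
     (vel u \<bullet> n) * Erad u, (vel u \<bullet> n) * Gam b p u)"
  using ext_pressure_data[OF assms, of p n] ext_vel_data[OF assms(1), of b p n]
  by (simp add: ext_flux_def ext_data_def Let_def)

lemma flux_components [simp]:
  "dens (flux p u x) = dens u * (vel u \<bullet> x)"
  "mom (flux p u x) = (mom u \<bullet> x) *\<^sub>R vel u + p u *\<^sub>R x"
  "Emech (flux p u x) = (Emech u + p u) * (vel u \<bullet> x)"
  "Erad (flux p u x) = Erad u * (vel u \<bullet> x)"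
  by (simp_all add: flux_def dens_def mom_def Emech_def Erad_def)

lemma linear_flux: "linear (flux p u)"
  by (rule linearI) (auto simp: flux_def inner_add_right algebra_simps)

text \<open>The frame velocity splits into its component along \<open>n\<close>, which enters the one-dimensional
  functional, and a transverse part, which contributes a multiple \<open>w\<close> of the density; \<open>w\<close> depends
  on the state through its transverse velocity.\<close>

lemma ext_functional_energy:
  fixes u :: "'d::finite state" and t n :: "real ^ 'd"
  assumes "dens u \<noteq> 0" "1 - b * dens u \<noteq> 0" "internal u \<noteq> 0"
  defines "w \<equiv> (t \<bullet> n)\<^sup>2 / 2 + transverse_energy n (vel u - t)"
  shows "ext_functional 1 (t \<bullet> n) w (ext_data b p n u) = energy_functional t u"
    and "ext_functional 1 (t \<bullet> n) w (ext_flux b (ext_data b p n u)) = energy_functional t (flux p u n)"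
proof -
  have m: "mom u = dens u *\<^sub>R vel u" using assms by (simp add: mom_eq)
  have sq: "norm (vel u) * norm (vel u) = vel u \<bullet> vel u"
    by (simp add: norm_eq_sqrt_inner)
  have w: "w = (t \<bullet> n)\<^sup>2 / 2 + (vel u \<bullet> vel u - 2 * (vel u \<bullet> t) + t \<bullet> t - (vel u \<bullet> n - t \<bullet> n)\<^sup>2) / 2"
    by (simp add: w_def transverse_energy_def inner_diff_left inner_diff_right inner_commute)
  show "ext_functional 1 (t \<bullet> n) w (ext_data b p n u) = energy_functional t u"
    by (simp add: ext_functional_def ext_data_def energy_functional_def m w
        sq power2_eq_square field_simps)
  show "ext_functional 1 (t \<bullet> n) w (ext_flux b (ext_data b p n u)) = energy_functional t (flux p u n)"
    unfolding ext_flux_data[OF assms(1-3)]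
    by (simp add: ext_functional_def energy_functional_def m w inner_add_left inner_commute[of n t]
        sq power2_eq_square field_simps)
qed

lemma ext_functional_dens:
  assumes "dens u \<noteq> 0"
  shows "ext_functional 0 0 r (ext_data b p n u) = r * dens u"
    and "ext_functional 0 0 r (ext_flux b (ext_data b p n u)) = r * dens (flux p u n)"
  using assms ext_vel_data[OF assms, of b p n]
  by (simp_all add: ext_functional_def ext_data_def ext_flux_def Let_def)

text \<open>The half-spaces \<open>l + k > 0\<close> whose intersection is the admissible set for the zero cold curve.\<close>

definition gas_functionals :: "real \<Rightarrow> (('d::finite state \<Rightarrow> real) \<times> real) set" where
  "gas_functionals b =
     {(dens, 0), (\<lambda>u. - b * dens u, 1), (Erad, 0)} \<union> range (\<lambda>t. (energy_functional t, 0))"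

lemma Aset_iff_functionals:
  "u \<in> Aset b (\<lambda>_. 0) \<longleftrightarrow> (\<forall>(l, k) \<in> gas_functionals b. l u + k > 0)"
  unfolding Aset_def Bset_def gas_functionals_def using internal_pos_iff[of u] by auto

lemma linear_gas_functional:
  assumes "(l, k) \<in> gas_functionals b"
  shows "linear l"
proof -
  have "linear (\<lambda>u. - b * dens u)"
    by (rule linearI) (auto simp: dens_def algebra_simps split: prod.split)
  then show ?thesis
    using assms linear_dens linear_Erad linear_energy_functional unfolding gas_functionals_def by auto
qed

lemma Aset_convex:
  fixes u u' :: "'d::finite state"
  assumes "u \<in> Aset b (\<lambda>_. 0)" "u' \<in> Aset b (\<lambda>_. 0)" and t: "0 < t" "t < 1"
  shows "t *\<^sub>R u + (1 - t) *\<^sub>R u' \<in> Aset b (\<lambda>_. 0)"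
  unfolding Aset_iff_functionals
proof safe
  fix l :: "'d state \<Rightarrow> real" and k assume lk: "(l, k) \<in> gas_functionals b"
  have "l (t *\<^sub>R u + (1 - t) *\<^sub>R u') + k = t * (l u + k) + (1 - t) * (l u' + k)"
    unfolding linear_add[OF linear_gas_functional[OF lk]] linear_scale[OF linear_gas_functional[OF lk]]
    by (simp add: algebra_simps)
  also have "\<dots> > 0"
  proof -
    have "l u + k > 0" "l u' + k > 0"
      using assms(1,2) lk unfolding Aset_iff_functionals by blast+
    then show ?thesis using t by (simp add: add_pos_pos)
  qed
  finally show "l (t *\<^sub>R u + (1 - t) *\<^sub>R u') + k > 0" .
qed

lemma ext_energy_pos:
  assumes "U \<in> ext_states b" and "w \<ge> 0"
  shows "ext_functional 1 \<beta> (\<beta>\<^sup>2 / 2 + w) U > 0"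
proof -
  obtain \<rho> q E R G where U: "U = (\<rho>, q, E, R, G)" by (cases U)
  have \<rho>: "\<rho> > 0" and e: "E / \<rho> - (q / \<rho>)\<^sup>2 / 2 > 0"
    using assms(1) by (auto simp: U ext_states_iff)
  have "ext_functional 1 \<beta> (\<beta>\<^sup>2 / 2 + w) U
      = \<rho> * ((E / \<rho> - (q / \<rho>)\<^sup>2 / 2) + ((q / \<rho> - \<beta>)\<^sup>2 / 2 + w))"
    using \<rho> by (simp add: U ext_functional_def power2_eq_square field_simps)
  also have "\<dots> > 0"
    using \<rho> e assms(2) by (intro mult_pos_pos add_pos_nonneg) auto
  finally show ?thesis .
qed

lemma ext_riemann_data:
  assumes "max_wave_speed_bound (ext_riemann b UL UR) s"
  shows "UL \<in> ext_states b" and "UR \<in> ext_states b"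
  using assms unfolding max_wave_speed_bound_def ext_riemann_def Let_def by auto

lemma internal_pos_of_ext_data:
  assumes "ext_data b p n u \<in> ext_states b"
  shows "internal u > 0" and "dens u > 0" and "1 - b * dens u > 0"
proof -
  have *: "dens u > 0 \<and> 1 - b * dens u > 0 \<and> ext_internal (ext_data b p n u) > 0"
    using assms by (auto simp: ext_data_def ext_states_iff ext_internal_def)
  then show "internal u > 0" "dens u > 0" "1 - b * dens u > 0"
    using ext_internal_data[of u b p n] by auto
qed

text \<open>For the radiation energy the functional is \<open>E\<^sub>r / \<rho>\<close> times the density, with the ratio frozen at the
  datum on each side. Positivity of the average thus follows from that of the density, and the
  radiation energy inside the waves never has to be computed.\<close>

lemma gas_functional_average_pos:
  fixes uL uR :: "'d::finite state"
  assumes lk: "(l, k) \<in> gas_functionals b" and n: "norm n = 1"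
    and bound: "max_wave_speed_bound (ext_riemann b (ext_data b p n uL) (ext_data b p n uR)) s"
    and rad: "Erad uL > 0" "Erad uR > 0"
  shows "s * (l uL + k) + s * (l uR + k) - (l (flux p uR n) - l (flux p uL n)) > 0"
proof -
  note L = internal_pos_of_ext_data[OF ext_riemann_data(1)[OF bound]]
  note R = internal_pos_of_ext_data[OF ext_riemann_data(2)[OF bound]]
  have nz: "dens uL \<noteq> 0" "1 - b * dens uL \<noteq> 0" "internal uL \<noteq> 0"
    "dens uR \<noteq> 0" "1 - b * dens uR \<noteq> 0" "internal uR \<noteq> 0"
    using L R by auto
  have dens_pos: "ext_functional 0 0 r U > 0" if "U \<in> ext_states b" "r > 0" for r U
    using that by (cases U) (simp add: ext_states_iff ext_functional_def)
  from lk consider (dens) "l = dens" "k = 0" | (covolume) "l = (\<lambda>u. - b * dens u)" "k = 1"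
    | (rad) "l = Erad" "k = 0" | (energy) t where "l = energy_functional t" "k = 0"
    unfolding gas_functionals_def by auto
  then show ?thesis
  proof cases
    case dens
    show ?thesis
      using ext_riemann_average_pos[OF bound, of 0 0 1 0 1] dens_pos nz dens
      by (simp add: ext_functional_dens)
  next
    case covolume
    have "ext_functional 0 0 (- b) U + 1 > 0" if "U \<in> ext_states b" for U
      using that by (cases U) (simp add: ext_states_iff ext_functional_def)
    then show ?thesis
      using ext_riemann_average_pos[OF bound, of 0 0 "- b" 1 "- b"] nz covolume
      by (simp add: ext_functional_dens)
  next
    case rad
    have "Erad uL / dens uL > 0" "Erad uR / dens uR > 0" using L R assms(4,5) by auto
    then show ?thesis
      using ext_riemann_average_pos[OF bound, of 0 0 "Erad uL / dens uL" 0 "Erad uR / dens uR"]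
        dens_pos nz rad
      by (simp add: ext_functional_dens)
  next
    case energy
    show ?thesis
      using ext_riemann_average_pos[OF bound, of 1 "t \<bullet> n"
          "(t \<bullet> n)\<^sup>2 / 2 + transverse_energy n (vel uL - t)" 0
          "(t \<bullet> n)\<^sup>2 / 2 + transverse_energy n (vel uR - t)"]
        ext_energy_pos[OF _ transverse_energy_nonneg[OF n]]
      by (simp add: ext_functional_energy[OF nz(1-3)] ext_functional_energy[OF nz(4-6)] energy)
  qed
qed


definition rad_functional :: "real ^ 'd \<Rightarrow> 'd::finite rad_state \<Rightarrow> real" where
  "rad_functional t w = (case w of (\<rho>, q, Et) \<Rightarrow> Et - q \<bullet> t + \<rho> * (t \<bullet> t / 2))"

lemma linear_rad_functional: "linear (rad_functional t)"
  by (rule linearI)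
    (auto simp: rad_functional_def algebra_simps inner_add_left split: prod.split)

lemma linear_rad_flux: "linear (rad_flux w)"
  by (rule linearI) (auto simp: rad_flux_def inner_add_right algebra_simps split: prod.split)

text \<open>Here \<open>3 p\<^sub>r\<close> is the radiation energy, which plays the part of the internal energy.\<close>

lemma rad_functional_eq:
  assumes "\<rho> > 0"
  shows "rad_functional t (\<rho>, q, Et) =
    3 * rad_pressure (\<rho>, q, Et) + \<rho> * ((q /\<^sub>R \<rho> - t) \<bullet> (q /\<^sub>R \<rho> - t) / 2)"
proof -
  obtain v where v: "q = \<rho> *\<^sub>R v" using assms by (intro that[of "q /\<^sub>R \<rho>"]) simp
  have sq: "norm v * norm v = v \<bullet> v" by (simp add: norm_eq_sqrt_inner)
  show ?thesis
    using assms by (simp add: v rad_functional_def rad_pressure_def inner_diff_left inner_diff_right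
        inner_commute power2_eq_square sq field_simps)
qed

lemma rad_pressure_pos_iff:
  assumes "\<rho> > 0"
  shows "rad_pressure (\<rho>, q, Et) > 0 \<longleftrightarrow> (\<forall>t. rad_functional t (\<rho>, q, Et) > 0)"
proof
  assume "rad_pressure (\<rho>, q, Et) > 0"
  then show "\<forall>t. rad_functional t (\<rho>, q, Et) > 0"
    using assms by (auto simp: rad_functional_eq intro!: add_pos_nonneg)
next
  assume "\<forall>t. rad_functional t (\<rho>, q, Et) > 0"
  then have "rad_functional (q /\<^sub>R \<rho>) (\<rho>, q, Et) > 0" by blast
  then show "rad_pressure (\<rho>, q, Et) > 0" using assms by (simp add: rad_functional_eq)
qed

lemma rad1_pressure_data:
  "\<rho> > 0 \<Longrightarrow> rad1_pressure (rad1_data n (\<rho>, q, Et)) = rad_pressure (\<rho>, q, Et)"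
  by (simp add: rad1_pressure_def rad1_data_def rad_pressure_def)

text \<open>The transverse kinetic energy is constant in time, because density is; it enters as a multiple of the
  density and has no flux.\<close>

lemma rad1_functional_data:
  fixes q t n :: "real ^ 'd::finite"
  assumes "\<rho> > 0"
  defines "w \<equiv> transverse_energy n (q /\<^sub>R \<rho> - t)"
  shows "rad1_functional (t \<bullet> n) w (rad1_data n (\<rho>, q, Et)) = rad_functional t (\<rho>, q, Et)"
    and "rad1_functional (t \<bullet> n) w (rad1_flux (rad1_data n (\<rho>, q, Et)))
      = rad_functional t (rad_flux (\<rho>, q, Et) n)"
proof -
  obtain v where v: "q = \<rho> *\<^sub>R v" using assms by (intro that[of "q /\<^sub>R \<rho>"]) simp
  have sq: "norm v * norm v = v \<bullet> v" by (simp add: norm_eq_sqrt_inner)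
  have w: "w = (v \<bullet> v - 2 * (v \<bullet> t) + t \<bullet> t - (v \<bullet> n - t \<bullet> n)\<^sup>2) / 2"
    using assms(1) by (simp add: v w_def transverse_energy_def inner_diff_left inner_diff_right inner_commute)
  show "rad1_functional (t \<bullet> n) w (rad1_data n (\<rho>, q, Et)) = rad_functional t (\<rho>, q, Et)"
    using assms(1) by (simp add: rad1_functional_def rad1_data_def rad_functional_def v w
        sq power2_eq_square field_simps)
  have "rad1_vel (rad1_data n (\<rho>, q, Et)) = v \<bullet> n"
    using assms(1) by (simp add: rad1_vel_def rad1_data_def v)
  then show "rad1_functional (t \<bullet> n) w (rad1_flux (rad1_data n (\<rho>, q, Et)))
      = rad_functional t (rad_flux (\<rho>, q, Et) n)"
    using assms(1)
    by (simp add: rad1_functional_def rad1_flux_def rad_functional_def rad_flux_def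
        rad1_pressure_data v inner_commute[of n t] algebra_simps)
qed

lemma rad_functional_average_pos:
  fixes wL wR :: "'d::finite rad_state"
  assumes n: "norm n = 1"
    and bound: "max_wave_speed_bound (rad1_riemann (rad1_data n wL) (rad1_data n wR)) s"
    and pos: "fst wL > 0" "fst wR > 0" "rad_pressure wL > 0" "rad_pressure wR > 0"
  shows "s * rad_functional t wL + s * rad_functional t wR
    - (rad_functional t (rad_flux wR n) - rad_functional t (rad_flux wL n)) > 0"
proof -
  obtain \<rho>L qL EL where L: "wL = (\<rho>L, qL, EL)" by (cases wL)
  obtain \<rho>R qR ER where R: "wR = (\<rho>R, qR, ER)" by (cases wR)
  have \<rho>: "\<rho>L > 0" "\<rho>R > 0" using pos by (auto simp: L R)
  show ?thesis
    using rad1_riemann_average_pos[OF bound _ _ transverse_energy_nonneg[OF n, of "qL /\<^sub>R \<rho>L - t"]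
        transverse_energy_nonneg[OF n, of "qR /\<^sub>R \<rho>R - t"], of "t \<bullet> n"] pos \<rho>
    by (simp add: L R rad1_pressure_data rad1_functional_data)
qed

section \<open>Graph viscosity updates\<close>

text \<open>The common form of both stages: \<open>f j x\<close> is the flux of the state \<open>z j\<close> in direction \<open>x\<close>.\<close>

definition graph_update ::
    "('i \<Rightarrow> 'i set) \<Rightarrow> ('i \<Rightarrow> real) \<Rightarrow> ('i \<Rightarrow> 'i \<Rightarrow> real ^ 'd::finite) \<Rightarrow>
     ('i \<Rightarrow> real ^ 'd \<Rightarrow> 'z::real_vector) \<Rightarrow> ('i \<Rightarrow> 'i \<Rightarrow> real) \<Rightarrow> real \<Rightarrow> ('i \<Rightarrow> 'z) \<Rightarrow> 'i \<Rightarrow> 'z" where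
  "graph_update N m c f d s z i =
     z i + (s / m i) *\<^sub>R
       (\<Sum>j\<in>N i. - (f j (c i j) + f i (c i j)) + d i j *\<^sub>R (z j - z i))"

text \<open>Subtracting \<open>2 f i (\<Sum>\<^sub>j c i j) = 0\<close> turns sums of fluxes into differences. This removes the diagonal term,
  although \<open>c i i\<close> may be nonzero at a boundary node.\<close>

lemma graph_update_differences:
  assumes "finite (N i)" and "linear (f i)" and c_sum: "(\<Sum>j\<in>N i. c i j) = 0"
  shows "graph_update N m c f d s z i =
     z i + (s / m i) *\<^sub>R
       (\<Sum>j\<in>N i - {i}. - (f j (c i j) - f i (c i j)) + d i j *\<^sub>R (z j - z i))"
proof -
  let ?t = "\<lambda>j. - (f j (c i j) - f i (c i j)) + d i j *\<^sub>R (z j - z i)"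
  have "(\<Sum>j\<in>N i. f i (c i j)) = 0"
    using linear_sum[OF assms(2), of "c i" "N i"] c_sum linear_0[OF assms(2)] by simp
  then have "(\<Sum>j\<in>N i. - (f j (c i j) + f i (c i j)) + d i j *\<^sub>R (z j - z i))
      = (\<Sum>j\<in>N i. - (f j (c i j) + f i (c i j)) + d i j *\<^sub>R (z j - z i))
        + (\<Sum>j\<in>N i. f i (c i j)) + (\<Sum>j\<in>N i. f i (c i j))" by simp
  also have "\<dots> = (\<Sum>j\<in>N i. ?t j)"
    unfolding sum.distrib[symmetric] by (rule sum.cong) auto
  also have "\<dots> = (\<Sum>j\<in>N i - {i}. ?t j)"
    using assms(1) by (intro sum.mono_neutral_right) auto
  finally show ?thesis unfolding graph_update_def by simp
qed

text \<open>The convex combination, with the weights \<open>2 d i j s / m i\<close> of the bar states multiplied out so that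
  \<open>d i j = 0\<close> causes no division by zero.\<close>

lemma linear_functional_graph_update:
  assumes "finite (N i)" and "linear (f i)" and "(\<Sum>j\<in>N i. c i j) = 0" and l: "linear l"
  shows "l (graph_update N m c f d s z i) + k =
     (1 - s * (2 / m i * (\<Sum>j\<in>N i - {i}. d i j))) * (l (z i) + k)
     + s / m i * (\<Sum>j\<in>N i - {i}. d i j * (l (z i) + k) + d i j * (l (z j) + k)
                    - (l (f j (c i j)) - l (f i (c i j))))"
proof -
  have "l (graph_update N m c f d s z i) = l (z i) + s / m i *
      (\<Sum>j\<in>N i - {i}. - (l (f j (c i j)) - l (f i (c i j))) + d i j * (l (z j) - l (z i)))"
    unfolding graph_update_differences[of N i f c m d s z, OF assms(1-3)]
    by (simp only: linear_add[OF l] linear_scale[OF l] linear_sum[OF l] linear_diff[OF l]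
        linear_neg[OF l] real_scaleR_def)
  also have "(\<Sum>j\<in>N i - {i}. - (l (f j (c i j)) - l (f i (c i j))) + d i j * (l (z j) - l (z i)))
    = (\<Sum>j\<in>N i - {i}. d i j * (l (z i) + k) + d i j * (l (z j) + k)
                    - (l (f j (c i j)) - l (f i (c i j))) + d i j * (- 2 * (l (z i) + k)))"
    by (rule sum.cong) (auto simp: algebra_simps)
  also have "\<dots> = (\<Sum>j\<in>N i - {i}. d i j * (l (z i) + k) + d i j * (l (z j) + k)
                    - (l (f j (c i j)) - l (f i (c i j)))) + (\<Sum>j\<in>N i - {i}. d i j) * (- 2 * (l (z i) + k))"
    by (simp only: sum.distrib sum_distrib_right)
  finally show ?thesis by (simp add: algebra_simps add_divide_distrib)
qed

lemma graph_viscosity_sym: "graph_viscosity lam c z i j = graph_viscosity lam c z j i"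
  by (simp add: graph_viscosity_def max.commute)

context discretization
begin

lemma finite_stencil: "i \<in> V \<Longrightarrow> finite (N i)"
  using stencil finite_V by (meson finite_subset psubset_imp_subset)

lemma graph_viscosity_nonneg:
  assumes lam: "\<And>i j. i \<in> V \<Longrightarrow> j \<in> N i - {i} \<Longrightarrow> c i j \<noteq> 0 \<Longrightarrow> lam (sgn (c i j)) (z i) (z j) > 0"
    and i: "i \<in> V" "j \<in> N i - {i}"
  shows "graph_viscosity lam c z i j \<ge> 0"
    and "graph_viscosity lam c z i j = 0 \<Longrightarrow> c i j = 0 \<and> c j i = 0"
proof -
  have j: "j \<in> V" "i \<in> N j - {j}" using i stencil stencil_sym by blast+
  have 1: "lam (sgn (c i j)) (z i) (z j) * norm (c i j) > 0" if "c i j \<noteq> 0"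
    using lam[OF i that] that by simp
  have 2: "lam (sgn (c j i)) (z j) (z i) * norm (c j i) > 0" if "c j i \<noteq> 0"
    using lam[OF j that] that by simp
  show "graph_viscosity lam c z i j \<ge> 0"
    using 1 unfolding graph_viscosity_def by (cases "c i j = 0") auto
  show "c i j = 0 \<and> c j i = 0" if "graph_viscosity lam c z i j = 0"
    using that 1 2 unfolding graph_viscosity_def by (auto simp: max_def split: if_splits)
qed

text \<open>If the maximum vanished, the time step bound would be \<open>inverse 0 = 0\<close>; a positive \<open>s\<close> excludes this.\<close>

lemma max_time_step_bound:
  assumes "i \<in> V" and "0 < s" and "s \<le> max_time_step V N m d"
  shows "s * (2 / m i * (\<Sum>j\<in>N i - {i}. d i j)) \<le> 1"
proof -
  let ?M = "Max ((\<lambda>i. 2 / m i * (\<Sum>j\<in>N i - {i}. d i j)) ` V)"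
  have "2 / m i * (\<Sum>j\<in>N i - {i}. d i j) \<le> ?M"
    using assms(1) finite_V by (intro Max_ge) auto
  moreover have "s \<le> inverse ?M" using assms(3) unfolding max_time_step_def .
  then have "?M > 0" using assms(2) by (meson less_le_trans inverse_positive_iff_positive)
  then have "s * ?M \<le> 1" using \<open>s \<le> inverse ?M\<close> by (simp add: field_simps)
  ultimately show ?thesis using assms(2) by (meson mult_left_mono less_imp_le order_trans)
qed

text \<open>The weight of \<open>z i\<close> may be zero when the time step is maximal, so strict positivity of the bar states
  is essential. The viscosity can be positive although \<open>c i j = 0\<close>, if \<open>c j i \<noteq> 0\<close> at a pair of
  boundary nodes; then the bar state is the mean of \<open>z i\<close> and \<open>z j\<close>, which is why positivity
  at \<open>z j\<close> is assumed in that case.\<close>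

lemma graph_update_functional_pos:
  fixes l :: "'z::real_vector \<Rightarrow> real"
  assumes l: "linear l" and f: "\<And>j. linear (f j)"
    and lam: "\<And>i j. i \<in> V \<Longrightarrow> j \<in> N i - {i} \<Longrightarrow> c i j \<noteq> 0 \<Longrightarrow> lam (sgn (c i j)) (y i) (y j) > 0"
    and i: "i \<in> V" and zi: "l (z i) + k > 0"
    and zj: "\<And>j. j \<in> N i - {i} \<Longrightarrow> c j i \<noteq> 0 \<Longrightarrow> l (z j) + k > 0"
    and average: "\<And>j s. j \<in> N i - {i} \<Longrightarrow> c i j \<noteq> 0 \<Longrightarrow> lam (sgn (c i j)) (y i) (y j) \<le> s \<Longrightarrow>
      s * (l (z i) + k) + s * (l (z j) + k) - (l (f j (sgn (c i j))) - l (f i (sgn (c i j)))) > 0"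
    and s: "s > 0" "s \<le> max_time_step V N m (graph_viscosity lam c y)"
  shows "l (graph_update N m c f (graph_viscosity lam c y) s z i) + k > 0"
proof -
  define d where "d = graph_viscosity lam c y"
  define B where "B j = d i j * (l (z i) + k) + d i j * (l (z j) + k)
    - (l (f j (c i j)) - l (f i (c i j)))" for j
  have d_nonneg: "d i j \<ge> 0" and d_0: "d i j = 0 \<Longrightarrow> c i j = 0 \<and> c j i = 0" if "j \<in> N i - {i}" for j
    unfolding d_def using graph_viscosity_nonneg[of lam y i j] lam i that by blast+
  have f0: "l (f j 0) = 0" for j
    using linear_0[OF f] linear_0[OF l] by simp
  have B_pos: "B j > 0" if j: "j \<in> N i - {i}" and "d i j > 0" for j
  proof (cases "c i j = 0")
    case True
    then have "c j i \<noteq> 0" using \<open>d i j > 0\<close> unfolding d_def graph_viscosity_def by auto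
    then show ?thesis
      using zi zj[OF j] \<open>d i j > 0\<close> True by (simp add: B_def f0 add_pos_pos)
  next
    case False
    let ?n = "sgn (c i j)"
    define s' where "s' = d i j / norm (c i j)"
    have d: "d i j = norm (c i j) * s'" using False by (simp add: s'_def)
    have lf: "l (f k' (c i j)) = norm (c i j) * l (f k' ?n)" for k'
    proof -
      have "c i j = norm (c i j) *\<^sub>R ?n" using False by (simp add: sgn_div_norm)
      then show ?thesis
        using linear_scale[OF f, of k' "norm (c i j)" ?n] linear_scale[OF l] by (metis real_scaleR_def)
    qed
    have "lam ?n (y i) (y j) * norm (c i j) \<le> d i j"
      unfolding d_def graph_viscosity_def by simp
    then have "lam ?n (y i) (y j) \<le> s'" using False by (simp add: s'_def field_simps)
    from mult_pos_pos[OF _ average[OF j False this], of "norm (c i j)"]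
    show ?thesis using False by (simp add: B_def lf d algebra_simps)
  qed
  have B_0: "B j = 0" if "j \<in> N i - {i}" "d i j = 0" for j
    using d_0[OF that] that by (simp add: B_def f0)
  have B_nonneg: "B j \<ge> 0" if "j \<in> N i - {i}" for j
    using B_pos[OF that] B_0[OF that] d_nonneg[OF that] by (cases "d i j = 0") auto
  define \<gamma> where "\<gamma> = s * (2 / m i * (\<Sum>j\<in>N i - {i}. d i j))"
  have \<gamma>: "\<gamma> \<le> 1" unfolding \<gamma>_def d_def using max_time_step_bound[OF i s] .
  have sm: "s / m i > 0" using s m_pos[OF i] by simp
  have eq: "l (graph_update N m c f d s z i) + k = (1 - \<gamma>) * (l (z i) + k) + s / m i * (\<Sum>j\<in>N i - {i}. B j)"
    unfolding \<gamma>_def B_def 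
    by (rule linear_functional_graph_update) (use finite_stencil i f c_sum l in auto)
  have sum_nonneg: "(\<Sum>j\<in>N i - {i}. B j) \<ge> 0" using B_nonneg by (rule sum_nonneg)
  have "(1 - \<gamma>) * (l (z i) + k) + s / m i * (\<Sum>j\<in>N i - {i}. B j) > 0"
  proof (cases "\<gamma> < 1")
    case True
    then have "(1 - \<gamma>) * (l (z i) + k) > 0" using zi by simp
    moreover have "s / m i * (\<Sum>j\<in>N i - {i}. B j) \<ge> 0"
      by (rule mult_nonneg_nonneg[OF less_imp_le[OF sm] sum_nonneg])
    ultimately show ?thesis by (rule add_pos_nonneg)
  next
    case False
    then have "\<gamma> = 1" using \<gamma> by simp
    then have "(\<Sum>j\<in>N i - {i}. d i j) \<noteq> 0" unfolding \<gamma>_def by auto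
    then obtain j where j: "j \<in> N i - {i}" "d i j \<noteq> 0" by (meson sum.neutral)
    then have "B j > 0" using B_pos d_nonneg by (simp add: less_le)
    then have "(\<Sum>j\<in>N i - {i}. B j) > 0"
      using j B_nonneg finite_stencil[OF i] by (intro sum_pos2[of _ j]) auto
    from mult_pos_pos[OF sm this] show ?thesis using \<open>\<gamma> = 1\<close> by simp
  qed
  then show ?thesis using eq unfolding d_def by simp
qed

lemma graph_update_isolated:
  assumes f: "\<And>j. linear (f j)" and i: "i \<in> V"
    and isolated: "\<And>j. j \<in> N i - {i} \<Longrightarrow> c i j = 0 \<and> c j i = 0"
  shows "graph_update N m c f (graph_viscosity lam c y) s z i = z i"
proof -
  have "(\<Sum>j\<in>N i - {i}. - (f j (c i j) - f i (c i j)) + graph_viscosity lam c y i j *\<^sub>R (z j - z i)) = 0"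
    using isolated linear_0[OF f] by (intro sum.neutral) (auto simp: graph_viscosity_def)
  then show ?thesis
    unfolding graph_update_differences[of N i f c m _ s z, OF finite_stencil[OF i] f c_sum[OF i]] by simp
qed

lemma sum_stencil_swap:
  fixes g :: "'i \<Rightarrow> 'i \<Rightarrow> 'z::comm_monoid_add"
  shows "(\<Sum>i\<in>V. \<Sum>j\<in>N i. g i j) = (\<Sum>j\<in>V. \<Sum>i\<in>N j. g i j)"
proof -
  have N: "N i = {j \<in> V. j \<in> N i}" if "i \<in> V" for i
    using stencil[OF that] by auto
  have "(\<Sum>i\<in>V. \<Sum>j\<in>N i. g i j) = (\<Sum>i\<in>V. \<Sum>j | j \<in> V \<and> j \<in> N i. g i j)"
    using N by (intro sum.cong refl) simp
  also have "\<dots> = (\<Sum>j\<in>V. \<Sum>i | i \<in> V \<and> j \<in> N i. g i j)"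
    by (rule sum.swap_restrict[OF finite_V finite_V])
  also have "\<dots> = (\<Sum>j\<in>V. \<Sum>i\<in>N j. g i j)"
    using N stencil_sym by (intro sum.cong refl) auto
  finally show ?thesis .
qed

text \<open>At interior nodes the skew symmetry of \<open>c\<close> turns column sums into row sums.\<close>

lemma column_sum:
  assumes "j \<in> V" and boundary: "\<forall>j\<in>Vbd. (\<Sum>i\<in>N j. c i j) = 0"
  shows "(\<Sum>i\<in>N j. c i j) = 0"
proof (cases "j \<in> Vbd")
  case True
  then show ?thesis using boundary by blast
next
  case False
  then have "j \<in> Vint" using assms(1) partition by auto
  then have "(\<Sum>i\<in>N j. c i j) = (\<Sum>i\<in>N j. - c j i)"
    using assms(1) c_skew stencil by (intro sum.cong refl) blast
  then show ?thesis using c_sum[OF assms(1)] by (simp add: sum_negf)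
qed

lemma graph_update_conservative:
  fixes z :: "'i \<Rightarrow> 'z::real_vector"
  assumes f: "\<And>j. linear (f j)" and d: "\<And>i j. d i j = d j i"
    and boundary: "\<forall>j\<in>Vbd. (\<Sum>i\<in>N j. c i j) = 0"
  shows "(\<Sum>i\<in>V. m i *\<^sub>R graph_update N m c f d s z i) = (\<Sum>i\<in>V. m i *\<^sub>R z i)"
proof -
  have "(\<Sum>i\<in>V. \<Sum>j\<in>N i. f i (c i j)) = 0"
  proof (rule sum.neutral, rule ballI)
    fix i assume "i \<in> V"
    then show "(\<Sum>j\<in>N i. f i (c i j)) = 0"
      using linear_sum[OF f, of i "c i" "N i"] c_sum linear_0[OF f] by simp
  qed
  moreover have "(\<Sum>i\<in>V. \<Sum>j\<in>N i. f j (c i j)) = 0"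
  proof (subst sum_stencil_swap, rule sum.neutral, rule ballI)
    fix j assume "j \<in> V"
    then show "(\<Sum>i\<in>N j. f j (c i j)) = 0"
      using linear_sum[OF f, of j "\<lambda>i. c i j" "N j"] column_sum[OF _ boundary] linear_0[OF f] by simp
  qed
  moreover have "(\<Sum>i\<in>V. \<Sum>j\<in>N i. d i j *\<^sub>R z j) = (\<Sum>i\<in>V. \<Sum>j\<in>N i. d i j *\<^sub>R z i)"
    by (subst sum_stencil_swap) (simp add: d)
  ultimately have 0: "(\<Sum>i\<in>V. \<Sum>j\<in>N i. - (f j (c i j) + f i (c i j)) + d i j *\<^sub>R (z j - z i)) = 0"
    by (simp add: sum.distrib sum_negf sum_subtractf scaleR_diff_right)
  have "(\<Sum>i\<in>V. m i *\<^sub>R graph_update N m c f d s z i)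
    = (\<Sum>i\<in>V. m i *\<^sub>R z i + s *\<^sub>R (\<Sum>j\<in>N i. - (f j (c i j) + f i (c i j)) + d i j *\<^sub>R (z j - z i)))"
    using m_pos by (intro sum.cong refl) (auto simp: graph_update_def scaleR_add_right less_imp_neq[symmetric])
  also have "\<dots> = (\<Sum>i\<in>V. m i *\<^sub>R z i)
      + s *\<^sub>R (\<Sum>i\<in>V. \<Sum>j\<in>N i. - (f j (c i j) + f i (c i j)) + d i j *\<^sub>R (z j - z i))"
    by (subst sum.distrib) (simp only: scaleR_sum_right)
  also have "\<dots> = (\<Sum>i\<in>V. m i *\<^sub>R z i)"
    unfolding 0 by simp
  finally show ?thesis .
qed


subsection \<open>The two hyperbolic stages\<close>

lemma stage1_eq_graph_update:
  "stage1 N m c p d s u = graph_update N m c (\<lambda>j. flux p (u j)) d s u"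
  by (simp add: fun_eq_iff stage1_def graph_update_def)

lemma stage2_rad_eq_graph_update:
  "stage2_rad N m c d s w = graph_update N m c (\<lambda>j. rad_flux (w j)) d s w"
  by (simp add: fun_eq_iff stage2_rad_def graph_update_def)

text \<open>Only \<open>internal (u i) > 0\<close> is assumed of internal energies: a neighbour that enters with a positive
  weight is a datum of a Riemann problem, which includes positivity of its internal energy.\<close>

lemma stage1_admissible:
  fixes u :: "'i \<Rightarrow> 'd state"
  assumes dens: "\<And>i. i \<in> V \<Longrightarrow> dens (u i) > 0 \<and> 1 - b * dens (u i) > 0"
    and rad: "\<And>i. i \<in> V \<Longrightarrow> Erad (u i) > 0"
    and bound: "\<And>i j. i \<in> V \<Longrightarrow> j \<in> N i - {i} \<Longrightarrow> c i j \<noteq> 0 \<Longrightarrow>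
          max_wave_speed_bound
            (ext_riemann b (ext_data b p (sgn (c i j)) (u i)) (ext_data b p (sgn (c i j)) (u j)))
            (lam (sgn (c i j)) (u i) (u j))"
    and i: "i \<in> V" and e: "internal (u i) > 0"
    and s: "s > 0" "s \<le> max_time_step V N m (graph_viscosity lam c u)"
  shows "stage1 N m c p (graph_viscosity lam c u) s u i \<in> Aset b (\<lambda>_. 0)"
  unfolding Aset_iff_functionals stage1_eq_graph_update
proof safe
  fix l :: "'d state \<Rightarrow> real" and k assume lk: "(l, k) \<in> gas_functionals b"
  have adm: "l (u j) + k > 0" if "j \<in> V" "internal (u j) > 0" for j
  proof -
    have "u j \<in> Aset b (\<lambda>_. 0)" using that dens rad by (simp add: Aset_def Bset_def)
    then show ?thesis using lk unfolding Aset_iff_functionals by blast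
  qed
  show "l (graph_update N m c (\<lambda>j. flux p (u j)) (graph_viscosity lam c u) s u i) + k > 0"
  proof (rule graph_update_functional_pos[OF linear_gas_functional[OF lk] linear_flux _ i _ _ _ s])
    show "lam (sgn (c i j)) (u i) (u j) > 0" if "i \<in> V" "j \<in> N i - {i}" "c i j \<noteq> 0" for i j
    proof -
      have "ext_functional 0 0 1 U + 0 > 0" if "U \<in> ext_states b" for U
        using that by (cases U) (simp add: ext_states_iff ext_functional_def)
      then show ?thesis
        using ext_riemann_average_pos[OF bound[OF that], of 0 0 1 0 1] by simp
    qed
    show "l (u i) + k > 0" using adm i e .
  next
    fix j assume j: "j \<in> N i - {i}"
    then have jV: "j \<in> V" "i \<in> N j - {j}" using i stencil stencil_sym by blast+
    show "l (u j) + k > 0" if "c j i \<noteq> 0"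
      using adm jV internal_pos_of_ext_data[OF ext_riemann_data(1)[OF bound[OF jV that]]] by blast
    show "s' * (l (u i) + k) + s' * (l (u j) + k)
        - (l (flux p (u j) (sgn (c i j))) - l (flux p (u i) (sgn (c i j)))) > 0"
      if "c i j \<noteq> 0" "lam (sgn (c i j)) (u i) (u j) \<le> s'" for s'
      using gas_functional_average_pos[OF lk _
          max_wave_speed_bound_mono[OF bound[OF i j that(1)] that(2)] rad[OF i] rad[OF jV(1)]] that(1)
      by (simp add: norm_sgn)
  qed
qed

lemma rad_pressure_to_rad: "rad_pressure (to_rad u) = Erad u / 3"
  by (simp add: rad_pressure_def to_rad_def vel_def)

lemma fst_to_rad [simp]: "fst (to_rad u) = dens u"
  by (simp add: to_rad_def)

lemma fst_rad_flux [simp]: "fst (rad_flux w x) = 0"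
  by (simp add: rad_flux_def split: prod.split)

lemma stage2_components:
  fixes u :: "'i \<Rightarrow> 'd state"
  assumes "stage2_rad N m c d s (\<lambda>j. to_rad (u j)) i = (\<rho>, q, Et)"
  shows "dens (stage2 N m c d s u i) = \<rho>"
    and "mom (stage2 N m c d s u i) = q"
    and "Emech (stage2 N m c d s u i)
      = Emech (u i) - dens (u i) * (norm (vel (u i)))\<^sup>2 / 2 + \<rho> * (norm (q /\<^sub>R \<rho>))\<^sup>2 / 2"
    and "Erad (stage2 N m c d s u i) = Et - \<rho> * (norm (q /\<^sub>R \<rho>))\<^sup>2 / 2"
  using assms by (simp_all add: stage2_def dens_def mom_def Emech_def Erad_def)

text \<open>The second stage keeps \<open>\<rho> e\<close> fixed by construction, so only density and radiation energy are at stake.\<close>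

lemma stage2_admissible:
  fixes u :: "'i \<Rightarrow> 'd state"
  defines "w \<equiv> \<lambda>i. to_rad (u i)"
  assumes dens: "\<And>i. i \<in> V \<Longrightarrow> dens (u i) > 0 \<and> 1 - b * dens (u i) > 0"
    and rad: "\<And>i. i \<in> V \<Longrightarrow> Erad (u i) > 0"
    and bound: "\<And>i j. i \<in> V \<Longrightarrow> j \<in> N i - {i} \<Longrightarrow> c i j \<noteq> 0 \<Longrightarrow>
          max_wave_speed_bound
            (rad1_riemann (rad1_data (sgn (c i j)) (w i)) (rad1_data (sgn (c i j)) (w j)))
            (mu (sgn (c i j)) (w i) (w j))"
    and i: "i \<in> V" and e: "internal (u i) > 0"
    and s: "s > 0" "s \<le> max_time_step V N m (graph_viscosity mu c w)"
  shows "stage2 N m c (graph_viscosity mu c w) s u i \<in> Aset b (\<lambda>_. 0)"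
proof -
  let ?d = "graph_viscosity mu c w"
  have w: "fst (w j) > 0" "1 - b * fst (w j) > 0" "rad_pressure (w j) > 0" if "j \<in> V" for j
    using dens[OF that] rad[OF that] by (simp_all add: w_def rad_pressure_to_rad)
  have mu: "mu (sgn (c i j)) (w i) (w j) > 0" if "i \<in> V" "j \<in> N i - {i}" "c i j \<noteq> 0" for i j
  proof -
    have "j \<in> V" using that stencil by blast
    then have "rad1_pressure (rad1_data n (w j)) > 0" "rad1_pressure (rad1_data n (w i)) > 0" for n
      using w[OF \<open>j \<in> V\<close>] w[OF that(1)]
      by (cases "w i"; cases "w j"; simp add: rad1_pressure_data)+
    then show ?thesis using rad1_riemann_average_pos[OF bound[OF that], of 0 0 0] by simp
  qed
  have l_pos: "l (stage2_rad N m c ?d s w i) + k > 0"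
    if "linear l" "\<And>j. j \<in> V \<Longrightarrow> l (w j) + k > 0"
      "\<And>j s. j \<in> N i - {i} \<Longrightarrow> c i j \<noteq> 0 \<Longrightarrow> mu (sgn (c i j)) (w i) (w j) \<le> s \<Longrightarrow>
        s * (l (w i) + k) + s * (l (w j) + k)
          - (l (rad_flux (w j) (sgn (c i j))) - l (rad_flux (w i) (sgn (c i j)))) > 0"
    for l :: "'d rad_state \<Rightarrow> real" and k
    unfolding stage2_rad_eq_graph_update
    using that i stencil[OF i]
    by (intro graph_update_functional_pos[OF that(1) linear_rad_flux mu i _ _ _ s]) blast+
  have fst_pos: "a * fst (stage2_rad N m c ?d s w i) + k > 0"
    if ak: "\<And>j. j \<in> V \<Longrightarrow> a * fst (w j) + k > 0" for a k
  proof (rule l_pos[of "\<lambda>w. a * fst w", OF _ ak])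
    show "linear (\<lambda>w :: 'd rad_state. a * fst w)"
      by (rule linearI) (auto simp: algebra_simps)
    fix j s' assume j: "j \<in> N i - {i}" "c i j \<noteq> 0" "mu (sgn (c i j)) (w i) (w j) \<le> s'"
    then have "j \<in> V" "s' > 0" using i stencil mu[OF i j(1,2)] by auto
    then show "s' * (a * fst (w i) + k) + s' * (a * fst (w j) + k)
      - (a * fst (rad_flux (w j) (sgn (c i j))) - a * fst (rad_flux (w i) (sgn (c i j)))) > 0"
      using ak[OF i] ak[OF \<open>j \<in> V\<close>] by (simp add: add_pos_pos)
  qed
  have functional_pos: "rad_functional t (stage2_rad N m c ?d s w i) + 0 > 0" for t
  proof (rule l_pos[OF linear_rad_functional])
    show "rad_functional t (w j) + 0 > 0" if "j \<in> V" for j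
      using w[OF that] rad_pressure_pos_iff by (cases "w j") auto
    fix j s' assume j: "j \<in> N i - {i}" "c i j \<noteq> 0" "mu (sgn (c i j)) (w i) (w j) \<le> s'"
    then have "j \<in> V" using i stencil by auto
    then show "s' * (rad_functional t (w i) + 0) + s' * (rad_functional t (w j) + 0)
      - (rad_functional t (rad_flux (w j) (sgn (c i j)))
         - rad_functional t (rad_flux (w i) (sgn (c i j)))) > 0"
      using rad_functional_average_pos[OF _ max_wave_speed_bound_mono[OF bound[OF i j(1,2)] j(3)], of t]
        w i j(2) by (simp add: norm_sgn)
  qed
  obtain \<rho> q Et where W: "stage2_rad N m c ?d s w i = (\<rho>, q, Et)" by (metis prod_cases3)
  note comp = stage2_components[OF W[unfolded w_def], folded w_def]
  have \<rho>: "\<rho> > 0" "1 - b * \<rho> > 0"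
    using fst_pos[of 1 0] fst_pos[of "- b" 1] w by (simp_all add: W)
  have "\<forall>t. rad_functional t (\<rho>, q, Et) > 0"
    using functional_pos by (simp add: W)
  then have "rad_pressure (\<rho>, q, Et) > 0"
    using rad_pressure_pos_iff[OF \<rho>(1)] by blast
  then have "Erad (stage2 N m c ?d s u i) > 0"
    by (simp add: comp rad_pressure_def)
  moreover have "internal (stage2 N m c ?d s u i) > 0"
  proof -
    have "dens (u i) * internal (u i) = Emech (u i) - dens (u i) * (norm (vel (u i)))\<^sup>2 / 2"
      using dens[OF i] by (simp add: internal_def field_simps)
    then have "internal (stage2 N m c ?d s u i) = dens (u i) * internal (u i) / \<rho>"
      using \<rho> by (simp add: internal_def vel_def comp add_divide_distrib)
    then show ?thesis using e dens[OF i] \<rho> by simp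
  qed
  ultimately show ?thesis
    using \<rho> by (simp add: Aset_def Bset_def comp)
qed

lemma stage1_isolated:
  fixes u :: "'i \<Rightarrow> 'd state"
  assumes "i \<in> V" and "\<And>j. j \<in> N i - {i} \<Longrightarrow> c i j = 0 \<and> c j i = 0"
  shows "stage1 N m c p (graph_viscosity lam c y) s u i = u i"
  unfolding stage1_eq_graph_update by (rule graph_update_isolated[OF linear_flux assms])

lemma stage2_isolated:
  fixes u :: "'i \<Rightarrow> 'd state"
  assumes "i \<in> V" and "\<And>j. j \<in> N i - {i} \<Longrightarrow> c i j = 0 \<and> c j i = 0"
  shows "stage2 N m c (graph_viscosity mu c y) s u i = u i"
proof -
  have "stage2_rad N m c (graph_viscosity mu c y) s (\<lambda>j. to_rad (u j)) i = to_rad (u i)"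
    unfolding stage2_rad_eq_graph_update by (rule graph_update_isolated[OF linear_rad_flux assms])
  then show ?thesis
    by (cases "u i") (simp add: stage2_def to_rad_def vel_def dens_def mom_def Emech_def Erad_def)
qed

lemma stage1_conservative:
  fixes u :: "'i \<Rightarrow> 'd state"
  assumes "\<And>i j. d i j = d j i" and "\<forall>j\<in>Vbd. (\<Sum>i\<in>N j. c i j) = 0"
  shows "(\<Sum>i\<in>V. m i *\<^sub>R stage1 N m c p d s u i) = (\<Sum>i\<in>V. m i *\<^sub>R u i)"
  unfolding stage1_eq_graph_update by (rule graph_update_conservative[OF linear_flux assms])

text \<open>For the total energy, the kinetic energies at the new time cancel, and what remains is \<open>E\<^sub>t\<close> plus a
  quantity that depends on the old state only.\<close>

lemma stage2_conservative:
  fixes u :: "'i \<Rightarrow> 'd state"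
  assumes d: "\<And>i j. d i j = d j i" and boundary: "\<forall>j\<in>Vbd. (\<Sum>i\<in>N j. c i j) = 0"
  shows "(\<Sum>i\<in>V. m i * dens (stage2 N m c d s u i)) = (\<Sum>i\<in>V. m i * dens (u i))"
    and "(\<Sum>i\<in>V. m i *\<^sub>R mom (stage2 N m c d s u i)) = (\<Sum>i\<in>V. m i *\<^sub>R mom (u i))"
    and "(\<Sum>i\<in>V. m i * Etot (stage2 N m c d s u i)) = (\<Sum>i\<in>V. m i * Etot (u i))"
proof -
  let ?w = "\<lambda>j. to_rad (u j)"
  define w2 where "w2 = stage2_rad N m c d s ?w"
  have "(\<Sum>i\<in>V. m i *\<^sub>R w2 i) = (\<Sum>i\<in>V. m i *\<^sub>R ?w i)"
    unfolding w2_def stage2_rad_eq_graph_update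
    by (rule graph_update_conservative[OF linear_rad_flux d boundary])
  from arg_cong[OF this, of fst] arg_cong[OF this, of "\<lambda>x. fst (snd x)"]
    arg_cong[OF this, of "\<lambda>x. snd (snd x)"]
  have sums: "(\<Sum>i\<in>V. m i * fst (w2 i)) = (\<Sum>i\<in>V. m i * fst (?w i))"
    "(\<Sum>i\<in>V. m i *\<^sub>R fst (snd (w2 i))) = (\<Sum>i\<in>V. m i *\<^sub>R fst (snd (?w i)))"
    "(\<Sum>i\<in>V. m i * snd (snd (w2 i))) = (\<Sum>i\<in>V. m i * snd (snd (?w i)))"
    by (simp_all add: fst_sum snd_sum)
  define K where "K i = dens (u i) * (norm (vel (u i)))\<^sup>2 / 2" for i
  have comp: "dens (stage2 N m c d s u i) = fst (w2 i)" "mom (stage2 N m c d s u i) = fst (snd (w2 i))"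
    "Etot (stage2 N m c d s u i) = snd (snd (w2 i)) + (Emech (u i) - K i)" for i
  proof -
    obtain \<rho> q Et where W: "w2 i = (\<rho>, q, Et)" by (metis prod_cases3)
    show "dens (stage2 N m c d s u i) = fst (w2 i)" "mom (stage2 N m c d s u i) = fst (snd (w2 i))"
      "Etot (stage2 N m c d s u i) = snd (snd (w2 i)) + (Emech (u i) - K i)"
      using stage2_components[OF W[unfolded w2_def]] by (simp_all add: W Etot_def K_def)
  qed
  have comp0: "dens (u i) = fst (?w i)" "mom (u i) = fst (snd (?w i))"
    "Etot (u i) = snd (snd (?w i)) + (Emech (u i) - K i)" for i
    by (simp_all add: to_rad_def Etot_def K_def)
  show "(\<Sum>i\<in>V. m i * dens (stage2 N m c d s u i)) = (\<Sum>i\<in>V. m i * dens (u i))"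
    unfolding comp using sums(1) by simp
  show "(\<Sum>i\<in>V. m i *\<^sub>R mom (stage2 N m c d s u i)) = (\<Sum>i\<in>V. m i *\<^sub>R mom (u i))"
    unfolding comp using sums(2) by (simp add: to_rad_def)
  show "(\<Sum>i\<in>V. m i * Etot (stage2 N m c d s u i)) = (\<Sum>i\<in>V. m i * Etot (u i))"
    unfolding comp comp0(3) using sums(3) by (simp add: distrib_left sum.distrib)
qed

lemma max_time_step_nonneg:
  assumes "V \<noteq> {}" and "\<And>i j. i \<in> V \<Longrightarrow> j \<in> N i - {i} \<Longrightarrow> d i j \<ge> 0"
  shows "max_time_step V N m d \<ge> 0"
proof -
  obtain i where i: "i \<in> V" using assms(1) by blast
  have "0 \<le> 2 / m i * (\<Sum>j\<in>N i - {i}. d i j)"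
    using assms(2)[OF i] m_pos[OF i] by (intro mult_nonneg_nonneg sum_nonneg) auto
  also have "\<dots> \<le> Max ((\<lambda>i. 2 / m i * (\<Sum>j\<in>N i - {i}. d i j)) ` V)"
    using i finite_V by (intro Max_ge) auto
  finally show ?thesis unfolding max_time_step_def by simp
qed

subsection \<open>Diffusion\<close>

text \<open>Discrete minimum principle: rewrite the row as a combination of differences \<open>E j - E i\<close>.\<close>

lemma diffusion_nonpos_at_minimum:
  assumes K: "diffusion_matrix V N K" and i: "i \<in> V" and min: "\<And>j. j \<in> V \<Longrightarrow> E i \<le> E j"
  shows "(\<Sum>j\<in>N i. K i j * E j) \<le> 0"
proof -
  have "(\<Sum>j\<in>N i. K i j * E j) = (\<Sum>j\<in>N i. K i j * (E j - E i)) + (\<Sum>j\<in>N i. K i j) * E i"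
    by (simp add: right_diff_distrib sum_subtractf sum_distrib_right)
  also have "\<dots> = (\<Sum>j\<in>N i. K i j * (E j - E i))"
    using K i by (simp add: diffusion_matrix_def)
  also have "\<dots> \<le> 0"
  proof (rule sum_nonpos)
    fix j assume j: "j \<in> N i"
    then have "E i \<le> E j" using min stencil[OF i] by blast
    then show "K i j * (E j - E i) \<le> 0"
      using K i j unfolding diffusion_matrix_def
      by (cases "j = i") (auto intro!: mult_nonpos_nonneg)
  qed
  finally show ?thesis .
qed

lemma diffusion_conservative:
  assumes K: "diffusion_matrix V N K"
  shows "(\<Sum>i\<in>V. \<Sum>j\<in>N i. K i j * E j) = 0"
proof -
  have "(\<Sum>i\<in>N j. K i j * E j) = 0" if j: "j \<in> V" for j
  proof -
    have "(\<Sum>i\<in>N j. K i j * E j) = (\<Sum>i\<in>N j. K j i) * E j"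
      unfolding sum_distrib_right using K j stencil[OF j]
      by (intro sum.cong refl) (auto simp: diffusion_matrix_def)
    then show ?thesis using K j by (simp add: diffusion_matrix_def)
  qed
  then show ?thesis by (subst sum_stencil_swap) simp
qed

end

section \<open>The parabolic update\<close>

text \<open>The integrand is only integrable and may be discontinuous, so the Lebesgue integral is used: if it
  vanished, \<open>f\<close> would be zero almost everywhere on a nonempty open interval.\<close>

lemma integral_pos_real:
  fixes f :: "real \<Rightarrow> real"
  assumes "0 < t" and pos: "\<And>x. 0 < x \<Longrightarrow> x < t \<Longrightarrow> f x > 0" and int: "f integrable_on {0..t}"
  shows "integral {0..t} f > 0"
proof -
  let ?S = "{0<..<t}"
  have S: "f integrable_on ?S" using int by (simp add: integrable_on_open_interval_real)
  have ai: "f absolutely_integrable_on ?S"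
    using S pos by (intro nonnegative_absolutely_integrable_1) (auto simp: less_imp_le)
  then have int': "integrable lebesgue (\<lambda>x. indicator ?S x *\<^sub>R f x)"
    unfolding set_integrable_def .
  have eq: "integral ?S f = integral\<^sup>L lebesgue (\<lambda>x. indicator ?S x *\<^sub>R f x)"
    using set_lebesgue_integral_eq_integral(2)[OF ai] unfolding set_lebesgue_integral_def by simp
  have nonneg: "integral ?S f \<ge> 0" using S pos by (intro integral_nonneg) (auto simp: less_imp_le)
  have "integral ?S f \<noteq> 0"
  proof
    assume "integral ?S f = 0"
    then have "AE x in lebesgue. indicator ?S x *\<^sub>R f x = 0"
      using integral_nonneg_eq_0_iff_AE[OF int'] eq pos
      by (auto simp: indicator_def less_imp_le)
    then have "AE x in lebesgue. x \<notin> ?S"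
      by (rule eventually_mono) (use pos in \<open>force simp: indicator_def\<close>)
    then have "negligible ?S"
      using AE_iff_null_sets[of ?S lebesgue] by (simp add: negligible_iff_null_sets)
    then show False using open_not_negligible[of ?S] \<open>0 < t\<close> by auto
  qed
  then show ?thesis using nonneg integral_open_interval_real[of 0 t f] by simp
qed

lemma (in material) avg_cv_pos:
  assumes "\<rho> \<in> dens_interval b" and "t > 0"
  shows "avg_cv hc \<rho> t > 0"
  using integral_pos_real[OF assms(2) hc_pos[OF assms(1)] hc_integrable[OF assms]] assms(2)
  by (simp add: avg_cv_def)

text \<open>At temperature zero the thermal energy would vanish, against \<open>e > e\<^sub>c\<^sub>o\<^sub>l\<^sub>d\<close>.\<close>

lemma (in material) temperature_pos:
  assumes "u \<in> Bset b ecold"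
  shows "T u > 0"
proof -
  have "avg_cv hc (dens u) (T u) * T u > 0"
    using T_eq[OF assms] assms by (simp add: Bset_def)
  then show ?thesis using T_nonneg[OF assms] by (cases "T u = 0") auto
qed

text \<open>The output satisfies the linear system of the last pass with a positive frozen temperature: the
  initial one, or the positive result of the preceding Newton iteration.\<close>

lemma parabolic_output_last_pass:
  assumes run: "parabolic_output V N m K ecold cv \<sigma>a cl ar \<sigma>ref Eref \<epsilon> \<tau> Tn Th uh unew"
    and Tn: "\<And>i. i \<in> V \<Longrightarrow> Tn i > 0"
    and \<rho>: "\<rho> = (\<lambda>i. dens (uh i))"
  obtains Ts E Tl Tnew where
    "\<forall>i\<in>V. Ts i > 0 \<and>
      P1_eq cv \<sigma>a cl ar \<tau> (\<rho> i) (Th i) (Ts i) (Tl i) (E i) \<and>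
      P2_eq \<sigma>a cl ar \<tau> (m i) (\<rho> i) (Erad (uh i))
        (\<Sum>j\<in>N i. K \<rho> Ts i j * E j) (Ts i) (Tl i) (E i) \<and>
      P1_eq cv \<sigma>a cl ar \<tau> (\<rho> i) (Th i) (Ts i) (Tnew i) (E i) \<and>
      unew i = (\<rho> i, mom (uh i),
        \<rho> i * (cv (\<rho> i) (Ts i) * Tnew i + ecold (\<rho> i)
          + (norm (mom (uh i) /\<^sub>R \<rho> i))\<^sup>2 / 2), E i)"
  using run unfolding parabolic_output_def Let_def
proof (elim exE conjE)
  fix k Ts E Tl Tnew
  assume Ts0: "\<forall>i\<in>V. Ts 0 i = Tn i"
    and pass: "\<forall>l\<le>k. \<forall>i\<in>V.
      P1_eq cv \<sigma>a cl ar \<tau> (dens (uh i)) (Th i) (Ts l i) (Tl l i) (E l i) \<and>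
      P2_eq \<sigma>a cl ar \<tau> (m i) (dens (uh i)) (Erad (uh i))
        (\<Sum>j\<in>N i. K (\<lambda>i. dens (uh i)) (Ts l) i j * E l j) (Ts l i) (Tl l i) (E l i) \<and>
      Ts (Suc l) i > 0 \<and>
      \<bar>newton_residual cv \<sigma>a cl ar \<tau> (m i) (dens (uh i)) (Th i) (E l i) (Ts (Suc l) i)\<bar>
        \<le> \<epsilon> * \<tau> * \<sigma>ref * cl * Eref"
    and out: "\<forall>i\<in>V.
      P1_eq cv \<sigma>a cl ar \<tau> (dens (uh i)) (Th i) (Ts k i) (Tnew i) (E k i) \<and>
      unew i = (dens (uh i), mom (uh i),
        dens (uh i) * (cv (dens (uh i)) (Ts k i) * Tnew i + ecold (dens (uh i))
          + (norm (mom (uh i) /\<^sub>R dens (uh i)))\<^sup>2 / 2), E k i)"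
  note last = pass[THEN spec, THEN mp, OF order_refl, THEN bspec]
  have "Ts k i > 0" if i: "i \<in> V" for i
  proof (cases k)
    case 0
    then show ?thesis using Ts0 Tn i by simp
  next
    case (Suc l)
    then have "l \<le> k" by simp
    then show ?thesis using pass i unfolding Suc by blast
  qed
  then show thesis
    using last out by (intro that[of "Ts k" "Tl k" "E k" Tnew, unfolded \<rho>]) blast
qed

text \<open>At a node where \<open>E\<close> is minimal, \<open>KE \<le> 0\<close>. If \<open>E\<close> were nonpositive, the first equation would make the
  exchange term nonnegative, so the second equation would have a negative left and a nonnegative
  right side.\<close>

lemma implicit_exchange_pos:
  fixes A B a H E E0 mi \<tau> KE T :: real
  assumes pos: "A > 0" "B \<ge> 0" "a > 0" "H > 0" "E0 > 0" "mi > 0" "\<tau> > 0" and "KE \<le> 0"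
    and P1: "A * T - H = - B * (a * T - E)"
    and P2: "mi * (E - E0) + \<tau> * KE = mi * B * (a * T - E)"
  shows "E > 0"
proof (rule ccontr)
  assume "\<not> E > 0"
  then have E: "E \<le> 0" by simp
  have "(A + B * a) * (a * T - E) = a * H - A * E"
    using arg_cong[OF P1, of "\<lambda>x. a * x"] by (simp add: algebra_simps)
  also have "\<dots> > 0"
    using mult_pos_pos[of a H] mult_nonneg_nonpos[of A E] pos E by linarith
  finally have "(A + B * a) * (a * T - E) > 0" .
  moreover have "A + B * a > 0" using pos by (simp add: add_pos_nonneg)
  ultimately have "a * T - E > 0" by (rule zero_less_mult_pos)
  then have "mi * B * (a * T - E) \<ge> 0" using pos by simp
  moreover have "mi * (E - E0) < 0" using pos E by (intro mult_pos_neg) auto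
  moreover have "\<tau> * KE \<le> 0" using pos \<open>KE \<le> 0\<close> by (intro mult_nonneg_nonpos) auto
  ultimately show False using P2 by linarith
qed

lemma implicit_temperature_pos:
  fixes A B a H E T :: real
  assumes pos: "A > 0" "B \<ge> 0" "a > 0" "H > 0" "E > 0"
    and P1: "A * T - H = - B * (a * T - E)"
  shows "T > 0"
proof -
  have "(A + B * a) * T = H + B * E" using P1 by (simp add: algebra_simps)
  also have "\<dots> > 0" using pos by (simp add: add_pos_nonneg)
  finally have "(A + B * a) * T > 0" .
  moreover have "A + B * a > 0" using pos by (simp add: add_pos_nonneg)
  ultimately show ?thesis by (rule zero_less_mult_pos)
qed

section \<open>Invariant domain and conservation\<close>

theorem theorem5p6:
  fixes V Vint Vbd :: "'i set"
    and N :: "'i \<Rightarrow> 'i set"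
    and m :: "'i \<Rightarrow> real"
    and M :: "'i \<Rightarrow> 'i \<Rightarrow> real"
    and c :: "'i \<Rightarrow> 'i \<Rightarrow> real ^ 'd::finite"
    and K :: "('i \<Rightarrow> real) \<Rightarrow> ('i \<Rightarrow> real) \<Rightarrow> 'i \<Rightarrow> 'i \<Rightarrow> real"
    and b cl ar \<sigma>ref Eref \<epsilon> \<tau> \<tau>1 \<tau>2 \<theta> :: real
    and ecold :: "real \<Rightarrow> real"
    and hc \<sigma>a \<sigma>t :: "real \<Rightarrow> real \<Rightarrow> real"
    and p T :: "'d state \<Rightarrow> real"
    and lam :: "real ^ 'd \<Rightarrow> 'd state \<Rightarrow> 'd state \<Rightarrow> real"
    and mu :: "real ^ 'd \<Rightarrow> 'd rad_state \<Rightarrow> 'd rad_state \<Rightarrow> real"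
    and d1 d2 :: "'i \<Rightarrow> 'i \<Rightarrow> real"
    and u uh unew :: "'i \<Rightarrow> 'd state"
    and w :: "'i \<Rightarrow> 'd rad_state"
  assumes dim: "CARD('d) \<in> {1, 2, 3}"
    and material: "material b ecold hc T \<sigma>a \<sigma>t cl ar"
    and discretization: "discretization V Vint Vbd N m M c"
    and diffusion: "\<And>\<rho> t. (\<And>i. i \<in> V \<Longrightarrow> \<rho> i \<in> dens_interval b \<and> t i > 0) \<Longrightarrow>
                      diffusion_matrix V N (K \<rho> t)"
    and admissible: "\<And>i. i \<in> V \<Longrightarrow> u i \<in> Aset b ecold"
    and w_def: "\<And>i. w i = to_rad (u i)"
    and lam_bound: "\<And>i j. i \<in> V \<Longrightarrow> j \<in> N i - {i} \<Longrightarrow> c i j \<noteq> 0 \<Longrightarrow>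
          max_wave_speed_bound
            (ext_riemann b (ext_data b p (sgn (c i j)) (u i)) (ext_data b p (sgn (c i j)) (u j)))
            (lam (sgn (c i j)) (u i) (u j))"
    and mu_bound: "\<And>i j. i \<in> V \<Longrightarrow> j \<in> N i - {i} \<Longrightarrow> c i j \<noteq> 0 \<Longrightarrow>
          max_wave_speed_bound
            (rad1_riemann (rad1_data (sgn (c i j)) (w i)) (rad1_data (sgn (c i j)) (w j)))
            (mu (sgn (c i j)) (w i) (w j))"
    and d1_def: "d1 = graph_viscosity lam c u"
    and d2_def: "d2 = graph_viscosity mu c w"
    and \<tau>1_def: "\<tau>1 = max_time_step V N m d1"
    and \<tau>2_def: "\<tau>2 = max_time_step V N m d2"
    and \<theta>_def: "\<theta> = \<tau>2 / (\<tau>1 + \<tau>2)"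
    and \<tau>_pos: "\<tau> > 0"
    and \<tau>_le: "\<tau> \<le> \<tau>1 * \<tau>2 / (\<tau>1 + \<tau>2)"
    and uh_def: "\<And>i. uh i = \<theta> *\<^sub>R stage1 N m c p d1 (\<tau> / \<theta>) u i
                         + (1 - \<theta>) *\<^sub>R stage2 N m c d2 (\<tau> / (1 - \<theta>)) u i"
    \<comment> \<open>the temperature of the hyperbolic update is defined; this is automatic where
        the cold curve is nonpositive\<close>
    and Th_defined: "\<And>i. i \<in> V \<Longrightarrow> ecold (dens (uh i)) > 0 \<Longrightarrow>
                       ecold (dens (uh i)) < internal (uh i)"
    and \<epsilon>_pos: "\<epsilon> > 0"
    and algorithm: "parabolic_output V N m K ecold (avg_cv hc) \<sigma>a cl ar \<sigma>ref Eref \<epsilon> \<tau>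
                   (\<lambda>i. T (u i)) (\<lambda>i. T (uh i)) uh unew"
  shows "(\<forall>i\<in>V. unew i \<in> Aset b ecold) \<and>
         \<comment> \<open>conservation, in the absence of boundary contributions\<close>
         ((\<forall>j\<in>Vbd. (\<Sum>i\<in>N j. c i j) = 0) \<longrightarrow>
           (\<Sum>i\<in>V. m i * dens (unew i)) = (\<Sum>i\<in>V. m i * dens (u i)) \<and>
           (\<Sum>i\<in>V. m i *\<^sub>R mom (unew i)) = (\<Sum>i\<in>V. m i *\<^sub>R mom (u i)) \<and>
           (\<Sum>i\<in>V. m i * Etot (unew i)) = (\<Sum>i\<in>V. m i * Etot (u i)))"
proof (cases "V = {}")
  case True
  then show ?thesis by simp
next
  case False
  interpret material b ecold hc T \<sigma>a \<sigma>t cl ar by fact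
  interpret discretization V Vint Vbd N m M c by fact
  have w: "w = (\<lambda>i. to_rad (u i))" using w_def by (simp add: fun_eq_iff)
  have dens_u: "dens (u i) > 0 \<and> 1 - b * dens (u i) > 0" and Erad_u: "Erad (u i) > 0"
    if "i \<in> V" for i
    using admissible[OF that] by (auto simp: Aset_def Bset_def)
  have lam_nonneg: "lam (sgn (c i j)) (u i) (u j) \<ge> 0" if "i \<in> V" "j \<in> N i - {i}" "c i j \<noteq> 0" for i j
    using lam_bound[OF that] unfolding max_wave_speed_bound_def by auto
  have mu_nonneg: "mu (sgn (c i j)) (w i) (w j) \<ge> 0" if "i \<in> V" "j \<in> N i - {i}" "c i j \<noteq> 0" for i j
    using mu_bound[OF that] unfolding max_wave_speed_bound_def by auto
  \<comment> \<open>If a maximal time step were zero, the bound on \<open>\<tau>\<close> would be zero too.\<close>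
  have \<tau>12: "\<tau>1 > 0" "\<tau>2 > 0"
  proof -
    have d1: "d1 i j \<ge> 0" if "i \<in> V" "j \<in> N i - {i}" for i j
      unfolding d1_def graph_viscosity_def using lam_nonneg[OF that]
      by (cases "c i j = 0") (auto simp: le_max_iff_disj)
    have d2: "d2 i j \<ge> 0" if "i \<in> V" "j \<in> N i - {i}" for i j
      unfolding d2_def graph_viscosity_def using mu_nonneg[OF that]
      by (cases "c i j = 0") (auto simp: le_max_iff_disj)
    have "\<tau>1 \<ge> 0" "\<tau>2 \<ge> 0"
      unfolding \<tau>1_def \<tau>2_def
      by (rule max_time_step_nonneg[OF False]; fact d1 d2)+
    moreover have "\<tau>1 * \<tau>2 / (\<tau>1 + \<tau>2) > 0" using \<tau>_pos \<tau>_le by linarith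
    then have "\<tau>1 \<noteq> 0" "\<tau>2 \<noteq> 0" by auto
    ultimately show "\<tau>1 > 0" "\<tau>2 > 0" by simp_all
  qed
  then have \<theta>: "0 < \<theta>" "\<theta> < 1" "1 - \<theta> = \<tau>1 / (\<tau>1 + \<tau>2)"
    unfolding \<theta>_def by (auto simp: field_simps)
  have s1: "\<tau> / \<theta> > 0" "\<tau> / \<theta> \<le> \<tau>1" and s2: "\<tau> / (1 - \<theta>) > 0" "\<tau> / (1 - \<theta>) \<le> \<tau>2"
  proof -
    show "\<tau> / \<theta> > 0" "\<tau> / (1 - \<theta>) > 0" using \<tau>_pos \<theta>(1,2) by auto
    show "\<tau> / \<theta> \<le> \<tau>1" "\<tau> / (1 - \<theta>) \<le> \<tau>2"
      unfolding \<theta>(3) unfolding \<theta>_def using \<tau>12 \<tau>_le by (simp_all add: field_simps)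
  qed
  \<comment> \<open>A node that takes part in no Riemann problem might have negative internal energy, but it is
      left unchanged.\<close>
  have uh_Aset: "uh i \<in> Aset b ecold" if i: "i \<in> V" for i
  proof (cases "\<forall>j\<in>N i - {i}. c i j = 0 \<and> c j i = 0")
    case True
    then have "uh i = \<theta> *\<^sub>R u i + (1 - \<theta>) *\<^sub>R u i"
      unfolding uh_def d1_def d2_def using stage1_isolated[OF i] stage2_isolated[OF i] by metis
    then have "uh i = u i" by (simp add: scaleR_add_left[symmetric])
    then show ?thesis using admissible[OF i] by simp
  next
    case False
    then obtain j where j: "j \<in> N i - {i}" "c i j \<noteq> 0 \<or> c j i \<noteq> 0" by blast
    then have jV: "j \<in> V" "i \<in> N j - {j}" using i stencil stencil_sym by blast+
    have e: "internal (u i) > 0"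
      using j(2) internal_pos_of_ext_data(1)[OF ext_riemann_data(1)[OF lam_bound[OF i j(1)]]]
        internal_pos_of_ext_data(1)[OF ext_riemann_data(2)[OF lam_bound[OF jV]]] by blast
    have "stage1 N m c p d1 (\<tau> / \<theta>) u i \<in> Aset b (\<lambda>_. 0)"
      unfolding d1_def
      by (rule stage1_admissible[OF dens_u Erad_u lam_bound i e s1[unfolded \<tau>1_def d1_def]])
    moreover have "stage2 N m c d2 (\<tau> / (1 - \<theta>)) u i \<in> Aset b (\<lambda>_. 0)"
      unfolding d2_def w
      by (rule stage2_admissible[OF dens_u Erad_u mu_bound[unfolded w] i e s2[unfolded \<tau>2_def d2_def w]])
    ultimately have "uh i \<in> Aset b (\<lambda>_. 0)"
      unfolding uh_def by (rule Aset_convex[OF _ _ \<theta>(1,2)])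
    then show ?thesis using Th_defined[OF i]
      by (cases "ecold (dens (uh i)) > 0") (auto simp: Aset_def Bset_def)
  qed
  then have uh_Bset: "uh i \<in> Bset b ecold" and Erad_uh: "Erad (uh i) > 0" if "i \<in> V" for i
    using that by (auto simp: Aset_def)
  define \<rho> where "\<rho> = (\<lambda>i. dens (uh i))"
  have \<rho>: "\<rho> i > 0" "\<rho> i \<in> dens_interval b" if "i \<in> V" for i
    using uh_Bset[OF that] by (auto simp: Bset_def \<rho>_def dens_interval_def)
  \<comment> \<open>\<open>H\<close> is the thermal energy of the hyperbolic update; \<open>A\<close>, \<open>B\<close> and \<open>a\<close> below are the coefficients
      of the linear system.\<close>
  define H where "H i = \<rho> i * (avg_cv hc (\<rho> i) (T (uh i)) * T (uh i))" for i
  have H: "H i > 0" "H i = \<rho> i * (internal (uh i) - ecold (\<rho> i))" if "i \<in> V" for i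
    using T_eq[OF uh_Bset[OF that]] uh_Bset[OF that] by (auto simp: H_def \<rho>_def Bset_def)
  have Tu: "T (u i) > 0" if "i \<in> V" for i
    using temperature_pos[of "u i"] admissible[OF that] by (simp add: Aset_def)
  obtain Ts E Tl Tnew where last: "\<forall>i\<in>V. Ts i > 0 \<and>
      P1_eq (avg_cv hc) \<sigma>a cl ar \<tau> (\<rho> i) (T (uh i)) (Ts i) (Tl i) (E i) \<and>
      P2_eq \<sigma>a cl ar \<tau> (m i) (\<rho> i) (Erad (uh i))
        (\<Sum>j\<in>N i. K \<rho> Ts i j * E j) (Ts i) (Tl i) (E i) \<and>
      P1_eq (avg_cv hc) \<sigma>a cl ar \<tau> (\<rho> i) (T (uh i)) (Ts i) (Tnew i) (E i) \<and>
      unew i = (\<rho> i, mom (uh i),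
        \<rho> i * (avg_cv hc (\<rho> i) (Ts i) * Tnew i + ecold (\<rho> i)
          + (norm (mom (uh i) /\<^sub>R \<rho> i))\<^sup>2 / 2), E i)"
    by (rule parabolic_output_last_pass[OF algorithm Tu \<rho>_def])
  then have Ts_pos: "Ts i > 0" if "i \<in> V" for i
    using that by blast
  define A where "A i = \<rho> i * avg_cv hc (\<rho> i) (Ts i)" for i
  define B where "B i = \<tau> * \<sigma>a (\<rho> i) (Ts i) * cl" for i
  define a where "a i = ar * Ts i ^ 3" for i
  define KE where "KE i = (\<Sum>j\<in>N i. K \<rho> Ts i j * E j)" for i
  have AB: "A i > 0" "B i \<ge> 0" "a i > 0" if "i \<in> V" for i
    using \<rho>[OF that] avg_cv_pos[OF \<rho>(2)[OF that] Ts_pos[OF that]]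
      \<sigma>a_nonneg[OF \<rho>(2)[OF that] Ts_pos[OF that]] Ts_pos[OF that] \<tau>_pos cl_pos ar_pos
    by (auto simp: A_def B_def a_def)
  have P1: "A i * Tl i - H i = - B i * (a i * Tl i - E i)"
    and P2: "m i * (E i - Erad (uh i)) + \<tau> * KE i = m i * B i * (a i * Tl i - E i)"
    and P1': "A i * Tnew i - H i = - B i * (a i * Tnew i - E i)" if "i \<in> V" for i
    using last[THEN bspec, OF that]
    by (simp_all add: P1_eq_def P2_eq_def A_def B_def a_def H_def KE_def algebra_simps)
  have K: "diffusion_matrix V N (K \<rho> Ts)"
    by (rule diffusion) (use \<rho> Ts_pos in auto)
  have E_pos: "E i > 0" if i: "i \<in> V" for i
  proof -
    obtain i0 where i0: "i0 \<in> V" "\<And>j. j \<in> V \<Longrightarrow> E i0 \<le> E j"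
      using ex_min_if_finite[of "E ` V"] finite_V False by (metis (mono_tags, lifting) arg_min_if_finite(1) arg_min_least)
    have "KE i0 \<le> 0" unfolding KE_def by (rule diffusion_nonpos_at_minimum[OF K]) (use i0 in auto)
    then have "E i0 > 0"
      using implicit_exchange_pos[OF AB[OF i0(1)] H(1)[OF i0(1)] Erad_uh[OF i0(1)] m_pos[OF i0(1)]
          \<tau>_pos _ P1[OF i0(1)] P2[OF i0(1)]] by blast
    then show ?thesis using i0(2)[OF i] by simp
  qed
  have Tnew_pos: "Tnew i > 0" if "i \<in> V" for i
    using implicit_temperature_pos[OF AB[OF that] H(1)[OF that] E_pos[OF that] P1'[OF that]] .
  have unew: "dens (unew i) = \<rho> i" "mom (unew i) = mom (uh i)" "vel (unew i) = vel (uh i)"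
    "Erad (unew i) = E i"
    "Emech (unew i) = A i * Tnew i + \<rho> i * (ecold (\<rho> i) + (norm (vel (uh i)))\<^sup>2 / 2)"
    if "i \<in> V" for i
    using last[THEN bspec, OF that]
    by (simp_all add: dens_def mom_def Erad_def Emech_def vel_def A_def \<rho>_def algebra_simps)
  have "unew i \<in> Aset b ecold" if i: "i \<in> V" for i
  proof -
    have "internal (unew i) = avg_cv hc (\<rho> i) (Ts i) * Tnew i + ecold (\<rho> i)"
      using \<rho>(1)[OF i] by (simp add: internal_def unew[OF i] A_def add_divide_distrib)
    moreover have "avg_cv hc (\<rho> i) (Ts i) * Tnew i > 0"
      using avg_cv_pos[OF \<rho>(2)[OF i] Ts_pos[OF i]] Tnew_pos[OF i] by simp
    ultimately show ?thesis
      using \<rho>[OF i] E_pos[OF i] by (simp add: Aset_def Bset_def unew[OF i] dens_interval_def)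
  qed
  moreover have "(\<Sum>i\<in>V. m i * dens (unew i)) = (\<Sum>i\<in>V. m i * dens (u i)) \<and>
      (\<Sum>i\<in>V. m i *\<^sub>R mom (unew i)) = (\<Sum>i\<in>V. m i *\<^sub>R mom (u i)) \<and>
      (\<Sum>i\<in>V. m i * Etot (unew i)) = (\<Sum>i\<in>V. m i * Etot (u i))"
    if boundary: "\<forall>j\<in>Vbd. (\<Sum>i\<in>N j. c i j) = 0"
  proof -
    let ?u1 = "stage1 N m c p d1 (\<tau> / \<theta>) u" and ?u2 = "stage2 N m c d2 (\<tau> / (1 - \<theta>)) u"
    have d: "d1 i j = d1 j i" "d2 i j = d2 j i" for i j
      unfolding d1_def d2_def by (rule graph_viscosity_sym)+
    have hyperbolic: "(\<Sum>i\<in>V. m i *\<^sub>R l (uh i)) = (\<Sum>i\<in>V. m i *\<^sub>R l (u i))"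
      if l: "linear l" and 2: "(\<Sum>i\<in>V. m i *\<^sub>R l (?u2 i)) = (\<Sum>i\<in>V. m i *\<^sub>R l (u i))"
      for l :: "'d state \<Rightarrow> 'z::real_vector"
    proof -
      have 1: "(\<Sum>i\<in>V. m i *\<^sub>R l (?u1 i)) = (\<Sum>i\<in>V. m i *\<^sub>R l (u i))"
        using arg_cong[OF stage1_conservative[of d1 p "\<tau> / \<theta>" u, OF d(1) boundary], of l]
        by (simp only: linear_sum[OF l] linear_scale[OF l])
      have "(\<Sum>i\<in>V. m i *\<^sub>R l (uh i))
          = \<theta> *\<^sub>R (\<Sum>i\<in>V. m i *\<^sub>R l (?u1 i)) + (1 - \<theta>) *\<^sub>R (\<Sum>i\<in>V. m i *\<^sub>R l (?u2 i))"
        by (simp add: uh_def linear_add[OF l] linear_scale[OF l] scaleR_sum_right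
            scaleR_add_right sum.distrib mult.commute)
      then show ?thesis unfolding 1 2 by (simp add: scaleR_add_left[symmetric])
    qed
    have "linear Etot"
      by (rule linearI) (auto simp: Etot_def Emech_def Erad_def algebra_simps split: prod.split)
    note sums2 = stage2_conservative[of d2 "\<tau> / (1 - \<theta>)" u, OF d(2) boundary]
    have "(\<Sum>i\<in>V. m i * dens (uh i)) = (\<Sum>i\<in>V. m i * dens (u i))"
      using hyperbolic[OF linear_dens] sums2(1) by simp
    moreover have "(\<Sum>i\<in>V. m i *\<^sub>R mom (uh i)) = (\<Sum>i\<in>V. m i *\<^sub>R mom (u i))"
      using hyperbolic[OF linear_mom] sums2(2) by simp
    moreover have "(\<Sum>i\<in>V. m i * Etot (uh i)) = (\<Sum>i\<in>V. m i * Etot (u i))"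
      using hyperbolic[OF \<open>linear Etot\<close>] sums2(3) by simp
    moreover have "(\<Sum>i\<in>V. m i * Etot (unew i)) = (\<Sum>i\<in>V. m i * Etot (uh i))"
    proof -
      have "m i * Etot (unew i) = m i * Etot (uh i) - \<tau> * KE i" if i: "i \<in> V" for i
      proof -
        \<comment> \<open>The temperature computed on exit is the one eliminated in the last pass, as both solve
            the same nonsingular equation.\<close>
        have "(A i + B i * a i) * Tl i = (A i + B i * a i) * Tnew i"
          using P1[OF i] P1'[OF i] by (simp add: algebra_simps)
        then have "Tl i = Tnew i"
          using AB[OF i] by (simp add: add_pos_nonneg less_imp_neq[symmetric])
        have "Emech (uh i) = \<rho> i * (internal (uh i) + (norm (vel (uh i)))\<^sup>2 / 2)"
          using \<rho>(1)[OF i] by (simp add: internal_def \<rho>_def)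
        then have "Etot (unew i) - Etot (uh i) = (A i * Tnew i - H i) + (E i - Erad (uh i))"
          by (simp add: Etot_def unew[OF i] H(2)[OF i] algebra_simps)
        then have "m i * (Etot (unew i) - Etot (uh i))
            = m i * (A i * Tnew i - H i) + m i * (E i - Erad (uh i))"
          by (simp only: distrib_left)
        also have "\<dots> = - \<tau> * KE i"
          using P2[OF i] unfolding P1'[OF i] \<open>Tl i = Tnew i\<close> by (simp add: algebra_simps)
        finally show ?thesis by (simp add: algebra_simps)
      qed
      then show ?thesis
        using diffusion_conservative[OF K, of E]
        by (simp add: sum_subtractf sum_distrib_left[symmetric] KE_def)
    qed
    ultimately show ?thesis by (simp add: unew \<rho>_def)
  qed
  ultimately show ?thesis by blast
qed

end
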